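(* Let $\mathscr E$ be a Hilbert $C^*$-module over a $C^*$-algebra and let $H,K\in\mathcal L(\mathscr E)$ be positive operators. Suppose that $H$ is nonsingular, i.e. $\overline{\mathscr R(H)}=\mathscr E$, and that $\overline{\mathscr R(H^{1/2}KH^{1/2})}$ is an orthogonally complemented submodule of $\mathscr E$. Then the following assertions are equivalent: (i) The equation $XHX=K$ has a positive solution $X\in\mathcal L(\mathscr E)$. (ii) $\mathscr R\big((H^{1/2}KH^{1/2})^{1/2}\big)\subseteq \mathscr R(H^{1/2})$ and $\mathscr R\Big(\big((H^{1/2})^{\dagger}(H^{1/2}KH^{1/2})^{1/2}\big)^*\Big)\subseteq \mathscr R(H^{1/2})$. (iii) $\mathscr R\big((H^{1/2}KH^{1/2})^{1/4}\big)\subseteq \mathscr R(H^{1/2})$. (iv) $\mathscr R\big((H^{1/2}KH^{1/2})^{1/2}\big)\subseteq \mathscr R(H^{1/2})$ and $(H^{1/2}KH^{1/2})^{1/2}\leq \lambda H$ for some scalar $\lambda>0$.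
   Context: $\mathcal L(\mathscr E)$ is the $C^*$-algebra of adjointable operators on $\mathscr E$; $\mathscr R(T)$ and $\mathscr N(T)$ are the range and null space of $T$. A closed submodule $\mathscr M\subseteq\mathscr E$ is orthogonally complemented if $\mathscr E=\mathscr M\oplus\mathscr M^\perp$. Fractional powers of positive operators are those given by the functional calculus. Moore--Penrose inverse: if $A\in\mathcal L(\mathscr E)$ and $\overline{\mathscr R(A^* )}$ is orthogonally complemented in $\mathscr E$, then $A^\dagger$ is the (possibly unbounded) linear operator with domain $\mathscr R(A)\oplus\mathscr N(A^* )$ determined by $A^\dagger Ax=x$ for $x\in\overline{\mathscr R(A^* )}$ and $A^\dagger y=0$ for $y\in\mathscr N(A^* )$. Since $H$ is nonsingular and positive, $\overline{\mathscr R(H^{1/2})}=\mathscr E$, so $(H^{1/2})^\dagger$ is defined. If $C\in\mathcal L(\mathscr E)$ and $\mathscr R(C)\subseteq\mathscr R(A)$, then $A^\dagger C$ is everywhere defined and belongs to $\mathcal L(\mathscr E)$ (it is the unique $D\in\mathcal L(\mathscr E)$ with $AD=C$ and $\mathscr R(D)\subseteq\mathscr N(A)^\perp$), so its adjoint makes sense; the second inclusion in (ii) is understood given the first. *)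

theory Defs
  imports
    "HOL-Analysis.Analysis"
    "HOL-Computational_Algebra.Polynomial"
begin

section \<open>C*-algebras and Hilbert C*-modules\<close>

class complex_banach = banach +
  fixes scaleC :: "complex \<Rightarrow> 'a \<Rightarrow> 'a"  (infixr \<open>*\<^sub>C\<close> 75)
  assumes scaleC_add_right: "c *\<^sub>C (x + y) = c *\<^sub>C x + c *\<^sub>C y"
    and scaleC_add_left: "(c + d) *\<^sub>C x = c *\<^sub>C x + d *\<^sub>C x"
    and scaleC_scaleC: "c *\<^sub>C d *\<^sub>C x = (c * d) *\<^sub>C x"
    and scaleC_of_real: "complex_of_real r *\<^sub>C x = r *\<^sub>R x"
    and norm_scaleC: "norm (c *\<^sub>C x) = cmod c * norm x"

text \<open>Not assumed to be unital.\<close>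

class cstar_algebra = complex_banach + real_normed_algebra +
  fixes star :: "'a \<Rightarrow> 'a"
  assumes mult_scaleC_left: "(c *\<^sub>C a) * b = c *\<^sub>C (a * b)"
    and mult_scaleC_right: "a * (c *\<^sub>C b) = c *\<^sub>C (a * b)"
    and star_add: "star (a + b) = star a + star b"
    and star_scaleC: "star (c *\<^sub>C a) = cnj c *\<^sub>C star a"
    and star_star: "star (star a) = a"
    and star_mult: "star (a * b) = star b * star a"
    and cstar_identity: "norm (star a * a) = (norm a)\<^sup>2"

text \<open>
  The spectrum of \<open>a\<close> in the unitization, whose elements are written \<open>b + w 1\<close>: the two last
  equations say that \<open>b + w 1\<close> is a two-sided inverse of \<open>z 1 - a\<close>. It always contains \<open>0\<close>, also
  when the algebra already has a unit; this does not affect positivity.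
\<close>

definition cstar_spectrum :: "'a::cstar_algebra \<Rightarrow> complex set" where
  "cstar_spectrum a =
     {z. \<not> (\<exists>b w. z * w = 1 \<and> z *\<^sub>C b - w *\<^sub>C a - a * b = 0 \<and> z *\<^sub>C b - w *\<^sub>C a - b * a = 0)}"

definition cstar_positive :: "'a::cstar_algebra \<Rightarrow> bool" where
  "cstar_positive a \<longleftrightarrow> star a = a \<and> cstar_spectrum a \<subseteq> \<real>\<^sub>\<ge>\<^sub>0"

text \<open>
  A right Hilbert module, with inner product linear in the second variable. The norm of the type
  \<open>'e\<close> is required to be the one induced by the inner product, so that completeness comes from the
  class and definiteness of the inner product from \<open>norm_eq_sqrt_ip\<close>.
\<close>

locale hilbert_cstar_module =
  fixes act :: "'e::complex_banach \<Rightarrow> 'a::cstar_algebra \<Rightarrow> 'e"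
    and ip :: "'e \<Rightarrow> 'e \<Rightarrow> 'a"
  assumes act_add_left: "act (x + y) a = act x a + act y a"
    and act_add_right: "act x (a + b) = act x a + act x b"
    and act_mult: "act x (a * b) = act (act x a) b"
    and act_scaleC_left: "act (c *\<^sub>C x) a = c *\<^sub>C act x a"
    and act_scaleC_right: "act x (c *\<^sub>C a) = c *\<^sub>C act x a"
    and ip_add_right: "ip x (y + z) = ip x y + ip x z"
    and ip_scaleC_right: "ip x (c *\<^sub>C y) = c *\<^sub>C ip x y"
    and ip_act_right: "ip x (act y a) = ip x y * a"
    and ip_star: "star (ip x y) = ip y x"
    and ip_positive: "cstar_positive (ip x x)"
    and norm_eq_sqrt_ip: "norm x = sqrt (norm (ip x x))"

definition orthogonal_complement :: "('e::complex_banach \<Rightarrow> 'e \<Rightarrow> 'a::cstar_algebra) \<Rightarrow> 'e set \<Rightarrow> 'e set"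
  where "orthogonal_complement ip M = {y. \<forall>x\<in>M. ip x y = 0}"

text \<open>The sum is automatically direct, the inner product being definite.\<close>

definition orthogonally_complemented :: "('e::complex_banach \<Rightarrow> 'e \<Rightarrow> 'a::cstar_algebra) \<Rightarrow> 'e set \<Rightarrow> bool"
  where "orthogonally_complemented ip M \<longleftrightarrow>
    (\<forall>z. \<exists>x\<in>M. \<exists>y\<in>orthogonal_complement ip M. z = x + y)"


section \<open>Adjointable operators\<close>

text \<open>
  Operators are plain functions, as an adjointable function is automatically linear over the
  coefficient algebra and bounded.
\<close>

definition adjointable :: "('e::complex_banach \<Rightarrow> 'e \<Rightarrow> 'a::cstar_algebra) \<Rightarrow> ('e \<Rightarrow> 'e) \<Rightarrow> bool" where
  "adjointable ip T \<longleftrightarrow> (\<exists>S. \<forall>x y. ip (T x) y = ip x (S y))"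

definition adj :: "('e::complex_banach \<Rightarrow> 'e \<Rightarrow> 'a::cstar_algebra) \<Rightarrow> ('e \<Rightarrow> 'e) \<Rightarrow> ('e \<Rightarrow> 'e)" where
  "adj ip T = (THE S. \<forall>x y. ip (T x) y = ip x (S y))"

definition op_spectrum :: "('e::complex_banach \<Rightarrow> 'e \<Rightarrow> 'a::cstar_algebra) \<Rightarrow> ('e \<Rightarrow> 'e) \<Rightarrow> complex set" where
  "op_spectrum ip T =
     {z. \<not> (\<exists>S. adjointable ip S \<and> S \<circ> (\<lambda>x. z *\<^sub>C x - T x) = id \<and> (\<lambda>x. z *\<^sub>C x - T x) \<circ> S = id)}"

definition op_positive :: "('e::complex_banach \<Rightarrow> 'e \<Rightarrow> 'a::cstar_algebra) \<Rightarrow> ('e \<Rightarrow> 'e) \<Rightarrow> bool" where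
  "op_positive ip T \<longleftrightarrow> adjointable ip T \<and> adj ip T = T \<and> op_spectrum ip T \<subseteq> \<real>\<^sub>\<ge>\<^sub>0"

definition op_le :: "('e::complex_banach \<Rightarrow> 'e \<Rightarrow> 'a::cstar_algebra) \<Rightarrow> ('e \<Rightarrow> 'e) \<Rightarrow> ('e \<Rightarrow> 'e) \<Rightarrow> bool" where
  "op_le ip S T \<longleftrightarrow> op_positive ip (\<lambda>x. T x - S x)"


section \<open>Continuous functional calculus\<close>

definition op_poly :: "real poly \<Rightarrow> ('e::complex_banach \<Rightarrow> 'e) \<Rightarrow> ('e \<Rightarrow> 'e)" where
  "op_poly p T = (\<lambda>x. \<Sum>i\<le>degree p. coeff p i *\<^sub>R (T ^^ i) x)"

text \<open>
  For a self-adjoint \<open>T\<close>, whose spectrum is real, and a real function \<open>f\<close> that is continuous on it: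
  the limit in operator norm of \<open>p\<^sub>n(T)\<close> for polynomials \<open>p\<^sub>n\<close> tending to \<open>f\<close> uniformly on the
  spectrum.
\<close>

definition op_cfc :: "('e::complex_banach \<Rightarrow> 'e \<Rightarrow> 'a::cstar_algebra) \<Rightarrow> (real \<Rightarrow> real) \<Rightarrow> ('e \<Rightarrow> 'e) \<Rightarrow> ('e \<Rightarrow> 'e)" where
  "op_cfc ip f T = (THE S. adjointable ip S \<and>
     (\<exists>p. uniform_limit {r. complex_of_real r \<in> op_spectrum ip T} (\<lambda>n. poly (p n)) f sequentially \<and>
          (\<lambda>n. onorm (\<lambda>x. op_poly (p n) T x - S x)) \<longlonglongrightarrow> 0))"

definition op_powr :: "('e::complex_banach \<Rightarrow> 'e \<Rightarrow> 'a::cstar_algebra) \<Rightarrow> ('e \<Rightarrow> 'e) \<Rightarrow> real \<Rightarrow> ('e \<Rightarrow> 'e)" where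
  "op_powr ip T \<alpha> = op_cfc ip (\<lambda>t. t powr \<alpha>) T"


section \<open>Moore-Penrose inverse\<close>

text \<open>
  The value at \<open>A x + y\<close> is \<open>x\<close>, for \<open>x\<close> in the closure of the range of \<open>A\<^sup>*\<close> and \<open>y\<close> in the null
  space of \<open>A\<^sup>*\<close>. Provided that this closure is orthogonally complemented, these vectors make up the
  domain \<open>R(A) + N(A\<^sup>*)\<close>; the value at a vector outside it is meaningless.
\<close>

definition mp_inverse :: "('e::complex_banach \<Rightarrow> 'e \<Rightarrow> 'a::cstar_algebra) \<Rightarrow> ('e \<Rightarrow> 'e) \<Rightarrow> ('e \<Rightarrow> 'e)" where
  "mp_inverse ip A z =
     (THE x. x \<in> closure (range (adj ip A)) \<and> (\<exists>y. adj ip A y = 0 \<and> z = A x + y))"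

end

theory Submission
  imports Defs "HOL-Computational_Algebra.Fundamental_Theorem_Algebra"
begin

text \<open>
  Put \<open>R = H\<^sup>1\<^sup>/\<^sup>2\<close> and \<open>G = R K R\<close>. The operator \<open>R\<close> is self-adjoint with dense range, so it is injective
  and can be cancelled on both sides (\<open>sandwich_cancel\<close>). For positive \<open>X\<close> the equation \<open>X H X = K\<close> is
  therefore equivalent to \<open>(R X R)\<^sup>2 = G\<close>, and, the positive square root being unique
  (\<open>op_powr_half_square\<close>), to

    \<open>R X R = G\<^sup>1\<^sup>/\<^sup>2\<close>.

  Such an \<open>X\<close> gives \<open>R\<^sup>-\<^sup>1 G\<^sup>1\<^sup>/\<^sup>2 = X R\<close>, whose adjoint \<open>R X\<close> has its range in that of \<open>R\<close>; this is (ii).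
  It gives \<open>G\<^sup>1\<^sup>/\<^sup>2 \<le> \<lambda> R\<^sup>2\<close> for every \<open>\<lambda>\<close> above the norm of \<open>X\<close>; this is (iv). Conversely, if \<open>R D = G\<^sup>1\<^sup>/\<^sup>4\<close>
  for an adjointable \<open>D\<close> then \<open>X = D D\<^sup>*\<close> is a solution, and if \<open>R D = G\<^sup>1\<^sup>/\<^sup>2\<close> and \<open>D\<^sup>* = R Y\<close> then
  \<open>G\<^sup>1\<^sup>/\<^sup>2 = R Y R\<close>, where \<open>Y\<close> is positive because its form is nonnegative on the range of \<open>R\<close>. The factors
  exist under (iii) and (ii) by \<open>range_inclusion_factor\<close>.

  The complementation hypothesis serves to reach (iii), from a solution as well as from (iv). In both
  cases the relation \<open>R w = G\<^sup>1\<^sup>/\<^sup>2 z\<close> forces \<open>norm w \<le> b * norm (G\<^sup>1\<^sup>/\<^sup>4 z)\<close>, so \<open>G\<^sup>1\<^sup>/\<^sup>4 z \<mapsto> w\<close> extends to the closure of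
  the range of \<open>G\<^sup>1\<^sup>/\<^sup>4\<close>. Complementation says that \<open>G\<^sup>1\<^sup>/\<^sup>4\<close> takes all its values already on this closure
  (\<open>root_range_inclusion\<close>).

  What has to be built for this is operator theory over a C*-algebra. It rests on a single set of
  results, proved in the locale \<open>cstar_form\<close> for an algebra-valued form that satisfies the
  Cauchy-Schwarz inequality, and used twice. Square roots come from the binomial series, and the norm of
  a real part of a normal element \<open>h + \<i> k\<close> with \<open>h\<^sup>2 + k\<^sup>2\<close> scalar replaces the spectral radius formula
  (\<open>commuting_squares_norm\<close>, \<open>norm_in_spec_aux\<close>). For the form \<open>star x * y\<close> on the algebra itself they show
  that \<open>-p \<le> q \<le> p\<close> bounds the norm of \<open>q\<close> by that of \<open>p\<close> (\<open>psd_sandwich\<close>), which yields the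
  Cauchy-Schwarz inequality of the module (\<open>norm_ip_le\<close>). For the module they then give the functional calculus, through
  \<open>norm_rpoly_le\<close>, and \<open>pos_if_form_nonneg\<close>, which recognizes positive operators by their form.
\<close>

section \<open>The Banach algebra of bounded complex-linear operators\<close>

text \<open>
  A type of its own, so that products, power series and limits of operators fall under the general
  theory of Banach algebras. The norm of the identity is only bounded by 1, since it is 0 on the
  trivial module.
\<close>

typedef (overloaded) 'e endo =
  "{T :: 'e::complex_banach \<Rightarrow> 'e. bounded_linear T \<and> (\<forall>c x. T (c *\<^sub>C x) = c *\<^sub>C T x)}"
  morphisms app Endo
proof -
  have "(\<lambda>x. 0) \<in> {T :: 'e \<Rightarrow> 'e. bounded_linear T \<and> (\<forall>c x. T (c *\<^sub>C x) = c *\<^sub>C T x)}"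
    using scaleC_add_right[of _ "0::'e" 0] by simp
  thus ?thesis by blast
qed

setup_lifting type_definition_endo

lemma scaleC_zero [simp]: "c *\<^sub>C (0::'e::complex_banach) = 0"
  using scaleC_add_right[of c "0::'e" 0] by simp

lemma scaleC_minus [simp]: "c *\<^sub>C (- x) = - (c *\<^sub>C (x::'e::complex_banach))"
  using scaleC_add_right[of c x "-x"] by (simp add: add_eq_0_iff)

lemma scaleC_diff: "c *\<^sub>C (x - y) = c *\<^sub>C x - c *\<^sub>C (y::'e::complex_banach)"
  using scaleC_add_right[of c x "-y"] by simp

lemma scaleC_one [simp]: "1 *\<^sub>C (x::'e::complex_banach) = x"
  using scaleC_of_real[of 1 x] by simp

lemma scaleC_commute: "c *\<^sub>C d *\<^sub>C x = d *\<^sub>C c *\<^sub>C (x::'e::complex_banach)"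
  by (simp add: scaleC_scaleC mult.commute)

lemma scaleR_scaleC: "r *\<^sub>R x = complex_of_real r *\<^sub>C (x::'e::complex_banach)"
  by (simp add: scaleC_of_real)

lemma scaleC_scaleR_commute: "c *\<^sub>C r *\<^sub>R x = r *\<^sub>R c *\<^sub>C (x::'e::complex_banach)"
  by (simp add: scaleR_scaleC scaleC_commute)

lemma bounded_linear_scaleC: "bounded_linear (\<lambda>x. c *\<^sub>C (x::'e::complex_banach))"
  by (rule bounded_linear_intro[where K = "cmod c"])
     (auto simp: scaleC_add_right scaleC_scaleR_commute norm_scaleC mult.commute)

lemma app_bounded_linear: "bounded_linear (app T)"
  and app_scaleC: "app T (c *\<^sub>C x) = c *\<^sub>C app T x"
  using app[of T] by auto

lemma app_add: "app T (x + y) = app T x + app T y"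
  and app_diff: "app T (x - y) = app T x - app T y"
  and app_zero [simp]: "app T 0 = 0"
  and app_scaleR: "app T (r *\<^sub>R x) = r *\<^sub>R app T x"
  using app_bounded_linear[of T]
  by (simp_all add: linear_simps bounded_linear.linear linear_0)

lemma endo_eqI: "(\<And>x. app S x = app T x) \<Longrightarrow> S = T"
  by (auto simp: app_inject[symmetric])

instantiation endo :: (complex_banach) real_normed_vector
begin

lift_definition zero_endo :: "'a endo" is "\<lambda>x. 0" by simp

lift_definition plus_endo :: "'a endo \<Rightarrow> 'a endo \<Rightarrow> 'a endo" is "\<lambda>S T x. S x + T x"
  by (simp add: bounded_linear_add scaleC_add_right)

lift_definition minus_endo :: "'a endo \<Rightarrow> 'a endo \<Rightarrow> 'a endo" is "\<lambda>S T x. S x - T x"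
  by (simp add: bounded_linear_sub scaleC_diff)

lift_definition uminus_endo :: "'a endo \<Rightarrow> 'a endo" is "\<lambda>T x. - T x"
  by (simp add: bounded_linear_minus)

lift_definition scaleR_endo :: "real \<Rightarrow> 'a endo \<Rightarrow> 'a endo" is "\<lambda>r T x. r *\<^sub>R T x"
  by (simp add: bounded_linear_const_scaleR scaleC_scaleR_commute)

lift_definition norm_endo :: "'a endo \<Rightarrow> real" is onorm .

definition "dist_endo (S::'a endo) T = norm (S - T)"
definition "sgn_endo (T::'a endo) = inverse (norm T) *\<^sub>R T"
definition [code del]:
  "uniformity_endo = (INF e\<in>{0<..}. principal {(S, T::'a endo). dist S T < e})"
definition [code del]:
  "open_endo (U :: 'a endo set) = (\<forall>S\<in>U. \<forall>\<^sub>F (S', T) in uniformity. S' = S \<longrightarrow> T \<in> U)"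

instance
proof
  fix S T V :: "'a endo" and r q :: real
  show "S + T + V = S + (T + V)" "S + T = T + S" "0 + S = S" "- S + S = 0" "S - T = S + - T"
    by (transfer, simp add: fun_eq_iff ac_simps)+
  show "r *\<^sub>R (S + T) = r *\<^sub>R S + r *\<^sub>R T" "(r + q) *\<^sub>R S = r *\<^sub>R S + q *\<^sub>R S"
    "r *\<^sub>R q *\<^sub>R S = (r * q) *\<^sub>R S" "1 *\<^sub>R S = S"
    by (transfer, simp add: fun_eq_iff scaleR_add_right scaleR_add_left)+
  show "sgn S = inverse (norm S) *\<^sub>R S" by (rule sgn_endo_def)
  show "dist S T = norm (S - T)" by (rule dist_endo_def)
  show "(norm S = 0) = (S = 0)"
    by transfer (auto simp: onorm_eq_0 fun_eq_iff)
  show "norm (S + T) \<le> norm S + norm T"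
    by transfer (simp add: onorm_triangle)
  show "norm (r *\<^sub>R S) = \<bar>r\<bar> * norm S"
    by transfer (simp add: onorm_scaleR)
qed (simp_all add: uniformity_endo_def open_endo_def)

end

lemma app_norm: "norm (app T x) \<le> norm T * norm x"
  by transfer (simp add: onorm)

lemma norm_endo_bound: "0 \<le> b \<Longrightarrow> (\<And>x. norm (app T x) \<le> b * norm x) \<Longrightarrow> norm T \<le> b"
  by transfer (rule onorm_bound)

lemma app_plus [simp]: "app (S + T) x = app S x + app T x"
  and app_minus [simp]: "app (S - T) x = app S x - app T x"
  and app_uminus [simp]: "app (- S) x = - app S x"
  and app_scaleR_left [simp]: "app (r *\<^sub>R S) x = r *\<^sub>R app S x"
  and app_0 [simp]: "app 0 x = 0"
  by (transfer, simp)+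

instantiation endo :: (complex_banach) "{monoid_mult, real_normed_algebra}"
begin

lift_definition one_endo :: "'a endo" is "\<lambda>x. x" by simp

lift_definition times_endo :: "'a endo \<Rightarrow> 'a endo \<Rightarrow> 'a endo" is "\<lambda>S T x. S (T x)"
  by (simp add: bounded_linear_compose)

instance
proof
  fix S T V :: "'a endo" and r :: real
  have [simp]: "app (S * T) x = app S (app T x)" for S T :: "'a endo" and x
    by transfer simp
  show "S * T * V = S * (T * V)" "(S + T) * V = S * V + T * V" "S * (T + V) = S * T + S * V"
    "r *\<^sub>R S * T = r *\<^sub>R (S * T)" "S * r *\<^sub>R T = r *\<^sub>R (S * T)"
    by (rule endo_eqI, simp add: app_add app_scaleR)+
  show "1 * S = S" "S * 1 = S"
    by (transfer, simp)+
  show "norm (S * T) \<le> norm S * norm T"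
  proof (rule norm_endo_bound)
    fix x
    have "norm (app S (app T x)) \<le> norm S * norm (app T x)" by (rule app_norm)
    also have "\<dots> \<le> norm S * (norm T * norm x)" by (intro mult_left_mono app_norm) simp
    finally show "norm (app (S * T) x) \<le> norm S * norm T * norm x" by simp
  qed simp
qed

end

lemma app_times [simp]: "app (S * T) x = app S (app T x)"
  and app_one [simp]: "app 1 x = x"
  by (transfer, simp)+

lemma app_power: "app (T ^ n) x = (app T ^^ n) x"
  by (induction n) simp_all

lemma norm_endo_one_le: "norm (1::'e::complex_banach endo) \<le> 1"
  by (rule norm_endo_bound) simp_all

lemma norm_endo_power_le: "norm (T ^ n) \<le> norm (T::'e::complex_banach endo) ^ n"
proof (induction n)
  case (Suc n)
  have "norm (T * T ^ n) \<le> norm T * norm (T ^ n)" by (rule norm_mult_ineq)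
  also have "\<dots> \<le> norm T * norm T ^ n" by (intro mult_left_mono Suc.IH) simp
  finally show ?case by simp
qed (simp add: norm_endo_one_le)

lemma bounded_linear_app: "bounded_linear (\<lambda>T. app T x)"
  by (rule bounded_linear_intro[where K = "norm x"])
     (use app_norm in \<open>simp_all add: mult.commute\<close>)

lemma tendsto_app: "(X \<longlongrightarrow> T) F \<Longrightarrow> ((\<lambda>n. app (X n) x) \<longlongrightarrow> app T x) F"
  by (rule bounded_linear.tendsto[OF bounded_linear_app])

lemma tendsto_app_right: "(y \<longlongrightarrow> x) F \<Longrightarrow> ((\<lambda>n. app T (y n)) \<longlongrightarrow> app T x) F"
  by (rule bounded_linear.tendsto[OF app_bounded_linear])

lemma app_sum: "app (\<Sum>i\<in>I. f i) x = (\<Sum>i\<in>I. app (f i) x)"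
  by (rule linear_sum[OF bounded_linear.linear[OF bounded_linear_app]])

instance endo :: (complex_banach) banach
proof
  fix X :: "nat \<Rightarrow> 'a endo"
  assume "Cauchy X"
  have app': "blinfun_apply (Blinfun (app T)) = app T" for T :: "'a endo"
    by (simp add: bounded_linear_Blinfun_apply app_bounded_linear)
  \<comment> \<open>completeness is inherited from the bounded real-linear maps\<close>
  have nrm: "norm (Blinfun (app S) - Blinfun (app T)) = norm (S - T)" for S T :: "'a endo"
  proof -
    have "blinfun_apply (Blinfun (app S) - Blinfun (app T)) = app (S - T)"
      by (rule ext) (simp add: blinfun.diff_left app')
    then show ?thesis by (simp add: norm_blinfun.rep_eq norm_endo.rep_eq)
  qed
  have "Cauchy (\<lambda>n. Blinfun (app (X n)))"
    using \<open>Cauchy X\<close> by (simp add: Cauchy_def dist_norm nrm)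
  then obtain L where L: "(\<lambda>n. Blinfun (app (X n))) \<longlonglongrightarrow> L"
    using Cauchy_convergent_iff convergent_def by blast
  have pt: "(\<lambda>n. app (X n) x) \<longlonglongrightarrow> blinfun_apply L x" for x
    using bounded_linear.tendsto[OF blinfun.bounded_linear_left L, of x] by (simp add: app')
  have "blinfun_apply L (c *\<^sub>C x) = c *\<^sub>C blinfun_apply L x" for c x
  proof (rule LIMSEQ_unique[OF pt])
    show "(\<lambda>n. app (X n) (c *\<^sub>C x)) \<longlonglongrightarrow> c *\<^sub>C blinfun_apply L x"
      unfolding app_scaleC by (rule bounded_linear.tendsto[OF bounded_linear_scaleC pt])
  qed
  then have L': "app (Endo (blinfun_apply L)) = blinfun_apply L"
    by (simp add: Endo_inverse blinfun.bounded_linear_right)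
  then have "Blinfun (app (Endo (blinfun_apply L))) = L"
    by (simp add: blinfun_apply_inverse)
  with L have "(\<lambda>n. norm (Blinfun (app (X n)) - Blinfun (app (Endo (blinfun_apply L))))) \<longlonglongrightarrow> 0"
    by (simp add: LIM_zero tendsto_norm_zero)
  then have "X \<longlonglongrightarrow> Endo (blinfun_apply L)"
    unfolding nrm by (simp add: tendsto_norm_zero_iff LIM_zero_iff)
  then show "convergent X" by (auto simp: convergent_def)
qed

text \<open>
  The scalar multiples of the identity. They are central because the operators are complex-linear,
  so that \<open>scal \<i>\<close> acts as an imaginary unit of the algebra.
\<close>

lift_definition scal :: "complex \<Rightarrow> 'e::complex_banach endo" is "\<lambda>c x. c *\<^sub>C x"
  by (simp add: bounded_linear_scaleC scaleC_commute)

lemma app_scal [simp]: "app (scal c) x = c *\<^sub>C x"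
  by transfer simp

lemma scal_commute: "scal c * T = T * scal c"
  by (rule endo_eqI) (simp add: app_scaleC)

lemma scal_mult: "scal (c * d) = scal c * scal d"
  and scal_add: "scal (c + d) = scal c + scal d"
  and scal_of_real: "scal (complex_of_real r) = r *\<^sub>R 1"
  by (rule endo_eqI, simp add: scaleC_scaleC scaleC_add_left scaleC_of_real)+

lemma scal_0 [simp]: "scal 0 = 0" and scal_1 [simp]: "scal 1 = 1"
  using scal_of_real[of 0] scal_of_real[of 1] by simp_all

lemma scal_minus: "scal (- c) = - scal c"
  using scal_add[of c "-c"] by (simp add: eq_neg_iff_add_eq_0 add.commute)

lemma norm_scal_le: "norm (scal c) \<le> cmod c"
  by (rule norm_endo_bound) (simp_all add: norm_scaleC)


section \<open>Square roots by the binomial series\<close>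

text \<open>
  The Taylor coefficients of \<open>sqrt (1 - x)\<close> at 0.
\<close>

definition sqrt_coeff :: "nat \<Rightarrow> real" where
  "sqrt_coeff n = (1/2 gchoose n) * (-1) ^ n"

lemma sqrt_coeff_sum_nonneg: "(\<Sum>k\<le>n. sqrt_coeff k) \<ge> 0"
proof -
  have "(\<Sum>k\<le>n. sqrt_coeff k) = (-1) ^ n * ((1/2 - 1) gchoose n)"
    unfolding sqrt_coeff_def by (rule gbinomial_sum_lower_neg)
  also have "\<dots> = (\<Prod>i<n. 1/2 + real i) / fact n"
  proof -
    have "(\<Prod>i<n. 1/2 + real i) = (\<Prod>i<n. (-1) * ((1/2 - 1) - real i))"
      by (rule prod.cong) auto
    also have "\<dots> = (-1) ^ n * (\<Prod>i<n. (1/2 - 1) - real i)"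
      unfolding prod.distrib by simp
    finally show ?thesis by (simp add: gbinomial_prod_rev atLeast0LessThan)
  qed
  also have "\<dots> \<ge> 0" by (intro divide_nonneg_nonneg prod_nonneg) auto
  finally show ?thesis .
qed

lemma sqrt_coeff_nonpos: "n > 0 \<Longrightarrow> sqrt_coeff n \<le> 0"
proof (induction n rule: nat_induct_non_zero)
  case 1
  show ?case by (simp add: sqrt_coeff_def)
next
  case (Suc n)
  have "(1/2 gchoose Suc n) * real (Suc n) = (1/2 gchoose n) * (1/2 - real n)"
    using gbinomial_factors gbinomial_mult_1[of "1/2::real" n] by (simp add: algebra_simps)
  then have step: "(1/2 gchoose Suc n) = (1/2 gchoose n) * (1/2 - real n) / real (Suc n)"
    by (simp add: field_simps del: of_nat_Suc)
  have "sqrt_coeff (Suc n) = sqrt_coeff n * ((real n - 1/2) / real (Suc n))"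
    unfolding sqrt_coeff_def step by (simp add: divide_simps) (simp add: algebra_simps)
  moreover have "(real n - 1/2) / real (Suc n) \<ge> 0" using Suc.hyps by simp
  ultimately show ?case using Suc.IH mult_nonpos_nonneg by metis
qed

text \<open>
  All coefficients but the first one, which is 1, are nonpositive, and the partial sums are
  nonnegative; so the absolute values add up to at most 2. This gives convergence on the closed unit
  ball, with the boundary included.
\<close>

lemma sqrt_coeff_summable: "summable (\<lambda>n. \<bar>sqrt_coeff n\<bar>)"
proof (rule summableI_nonneg_bounded)
  show "(\<Sum>k<n. \<bar>sqrt_coeff k\<bar>) \<le> 2" for n
  proof (cases n)
    case (Suc m)
    have split0: "(\<Sum>k\<le>m. f k) = f 0 + (\<Sum>k\<in>{1..m}. f k)" for f :: "nat \<Rightarrow> real"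
      using sum.atLeast_Suc_atMost[of 0 m f] by (simp add: atMost_atLeast0 del: sum.atLeast0_atMost_Suc)
    have "(\<Sum>k\<in>{1..m}. \<bar>sqrt_coeff k\<bar>) = - (\<Sum>k\<in>{1..m}. sqrt_coeff k)"
      unfolding sum_negf[symmetric] by (rule sum.cong) (auto simp: sqrt_coeff_nonpos abs_of_nonpos)
    then have "(\<Sum>k\<le>m. \<bar>sqrt_coeff k\<bar>) = 2 - (\<Sum>k\<le>m. sqrt_coeff k)"
      unfolding split0 by (simp add: sqrt_coeff_def)
    with sqrt_coeff_sum_nonneg[of m] Suc show ?thesis by (simp add: lessThan_Suc_atMost)
  qed simp
qed simp

text \<open>
  Vandermonde's identity for the exponents \<open>1/2 + 1/2 = 1\<close>: the square of the series is \<open>1 - x\<close>.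
\<close>

lemma sqrt_coeff_convolution:
  "(\<Sum>i\<le>n. sqrt_coeff i * sqrt_coeff (n - i)) = (if n = 0 then 1 else if n = 1 then -1 else 0)"
proof -
  have "(\<Sum>i\<le>n. sqrt_coeff i * sqrt_coeff (n - i)) =
    (\<Sum>i\<le>n. (1/2 gchoose i) * (1/2 gchoose (n - i))) * (-1) ^ n"
    unfolding sum_distrib_right
    by (rule sum.cong) (auto simp: sqrt_coeff_def power_add[symmetric])
  also have "\<dots> = (real 1 gchoose n) * (-1) ^ n"
    using gbinomial_Vandermonde[of "1/2::real" "1/2" n] by (simp add: atMost_atLeast0)
  also have "\<dots> = (if n = 0 then 1 else if n = 1 then -1 else 0)"
    unfolding binomial_gbinomial[symmetric] by (auto simp: binomial_eq_0)
  finally show ?thesis .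
qed

definition sqrt_one_minus :: "'e::complex_banach endo \<Rightarrow> 'e endo" where
  "sqrt_one_minus x = (\<Sum>n. sqrt_coeff n *\<^sub>R x ^ n)"

context
  fixes x :: "'e::complex_banach endo"
  assumes x: "norm x \<le> 1"
begin

lemma sqrt_one_minus_summable: "summable (\<lambda>n. norm (sqrt_coeff n *\<^sub>R x ^ n))"
proof (rule summable_comparison_test'[OF sqrt_coeff_summable])
  fix n
  have "norm (x ^ n) \<le> 1"
    using norm_endo_power_le[of x n] power_le_one[OF norm_ge_zero x, of n] by linarith
  then show "norm (norm (sqrt_coeff n *\<^sub>R x ^ n)) \<le> \<bar>sqrt_coeff n\<bar>"
    by (simp add: mult_left_le)
qed

lemma sqrt_one_minus_sums: "(\<lambda>n. sqrt_coeff n *\<^sub>R x ^ n) sums sqrt_one_minus x"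
  unfolding sqrt_one_minus_def 
  by (rule summable_sums[OF summable_norm_cancel[OF sqrt_one_minus_summable]])

lemma sqrt_one_minus_square: "sqrt_one_minus x * sqrt_one_minus x = 1 - x"
proof -
  let ?b = "\<lambda>k. sqrt_coeff k *\<^sub>R x ^ k"
  let ?c = "\<lambda>k. (if k = 0 then 1 else if k = 1 then -1 else 0) *\<^sub>R x ^ k"
  have "(\<Sum>i\<le>k. ?b i * ?b (k - i)) = ?c k" for k
  proof -
    have "(\<Sum>i\<le>k. ?b i * ?b (k - i)) = (\<Sum>i\<le>k. sqrt_coeff i * sqrt_coeff (k - i)) *\<^sub>R x ^ k"
      unfolding scaleR_sum_left by (rule sum.cong) (auto simp: power_add[symmetric])
    then show ?thesis by (simp add: sqrt_coeff_convolution)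
  qed
  then have "?c sums (sqrt_one_minus x * sqrt_one_minus x)"
    using Cauchy_product_sums[OF sqrt_one_minus_summable sqrt_one_minus_summable]
    by (simp add: sqrt_one_minus_def)
  moreover have "?c sums (\<Sum>k\<in>{0,1}. ?c k)"
    by (rule sums_finite) auto
  ultimately have "sqrt_one_minus x * sqrt_one_minus x = (\<Sum>k\<in>{0,1}. ?c k)"
    by (rule sums_unique2)
  then show ?thesis by simp
qed

lemma sqrt_one_minus_commute:
  assumes "z * x = x * z" shows "z * sqrt_one_minus x = sqrt_one_minus x * z"
proof -
  have comm: "z * x ^ n = x ^ n * z" for n
    using power_commuting_commutes[OF assms[symmetric], of n] by simp
  have 1: "(\<lambda>n. z * (sqrt_coeff n *\<^sub>R x ^ n)) sums (z * sqrt_one_minus x)"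
    by (rule sums_mult[OF sqrt_one_minus_sums])
  have eq: "(\<lambda>n. (sqrt_coeff n *\<^sub>R x ^ n) * z) = (\<lambda>n. z * (sqrt_coeff n *\<^sub>R x ^ n))"
    by (rule ext) (simp add: comm)
  have 2: "(\<lambda>n. z * (sqrt_coeff n *\<^sub>R x ^ n)) sums (sqrt_one_minus x * z)"
    using sums_mult2[OF sqrt_one_minus_sums, of z] unfolding eq .
  show ?thesis by (rule sums_unique2[OF 1 2])
qed

end

section \<open>Adjointable operators for an algebra-valued form\<close>

text \<open>
  The C*-identity and submultiplicativity give \<open>norm a \<le> norm (star a)\<close>; applied to \<open>star a\<close> it
  gives the converse.
\<close>

lemma norm_star [simp]: "norm (star a) = norm (a::'a::cstar_algebra)"
proof -
  have le: "norm b \<le> norm (star b)" for b :: 'a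
  proof (cases "b = 0")
    case False
    have "norm b * norm b \<le> norm (star b) * norm b"
      using cstar_identity[of b] norm_mult_ineq[of "star b" b] by (simp add: power2_eq_square)
    with False show ?thesis by simp
  qed simp
  from le[of a] le[of "star a"] show ?thesis by (simp add: star_star)
qed

lemma star_0 [simp]: "star (0::'a::cstar_algebra) = 0"
  using norm_star[of "0::'a"] by (metis norm_eq_zero)

lemma star_minus: "star (- a) = - star (a::'a::cstar_algebra)"
  using star_add[of a "-a"] by (simp add: eq_neg_iff_add_eq_0 add.commute)

lemma star_diff: "star (a - b) = star a - star (b::'a::cstar_algebra)"
  using star_add[of a "-b"] by (simp add: star_minus)

lemma star_scaleR: "star (r *\<^sub>R a) = r *\<^sub>R star (a::'a::cstar_algebra)"
  by (simp add: scaleR_scaleC star_scaleC)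

text \<open>
  What a C*-algebra acting on itself and a Hilbert module have in common. The Cauchy-Schwarz
  inequality is an axiom here, positivity of \<open>ip x x\<close> is not: the order on the coefficient algebra,
  and with it the Cauchy-Schwarz inequality of a Hilbert module, is derived from the results of this
  locale for the form \<open>star x * y\<close>.
\<close>

locale cstar_form =
  fixes ip :: "'e::complex_banach \<Rightarrow> 'e \<Rightarrow> 'a::cstar_algebra"
  assumes form_add_right: "ip x (y + z) = ip x y + ip x z"
    and form_scaleC_right: "ip x (c *\<^sub>C y) = c *\<^sub>C ip x y"
    and form_star: "star (ip x y) = ip y x"
    and norm_form_self: "norm (ip x x) = (norm x)\<^sup>2"
    and cauchy_schwarz: "norm (ip x y) \<le> norm x * norm y"
begin

lemma form_zero_right [simp]: "ip x 0 = 0"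
  using form_add_right[of x 0 0] by simp

lemma form_minus_right [simp]: "ip x (- y) = - ip x y"
  using form_add_right[of x y "-y"] by (simp add: eq_neg_iff_add_eq_0 add.commute)

lemma form_diff_right: "ip x (y - z) = ip x y - ip x z"
  using form_add_right[of x y "-z"] by simp

lemma form_scaleR_right [simp]: "ip x (r *\<^sub>R y) = r *\<^sub>R ip x y"
  by (simp add: scaleR_scaleC form_scaleC_right)

lemma form_add_left: "ip (x + y) z = ip x z + ip y z"
  by (metis form_add_right form_star star_add)

lemma form_diff_left: "ip (x - y) z = ip x z - ip y z"
  by (metis form_diff_right form_star star_diff)

lemma form_zero_left [simp]: "ip 0 x = 0"
  using form_add_left[of 0 0 x] by simp

lemma form_minus_left [simp]: "ip (- y) x = - ip y x"
  using form_add_left[of y "-y" x] by (simp add: eq_neg_iff_add_eq_0 add.commute)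

lemma form_scaleC_left: "ip (c *\<^sub>C x) y = cnj c *\<^sub>C ip x y"
  by (metis form_scaleC_right form_star star_scaleC)

lemma form_scaleR_left [simp]: "ip (r *\<^sub>R x) y = r *\<^sub>R ip x y"
  by (simp add: scaleR_scaleC form_scaleC_left)

lemma bounded_linear_form_right: "bounded_linear (ip x)"
  by (rule bounded_linear_intro[where K = "norm x"])
     (use cauchy_schwarz[of x] in \<open>simp_all add: form_add_right mult.commute\<close>)

lemma bounded_linear_form_left: "bounded_linear (\<lambda>x. ip x y)"
  by (rule bounded_linear_intro[where K = "norm y"])
     (use cauchy_schwarz[of _ y] in \<open>simp_all add: form_add_left mult.commute\<close>)

lemmas tendsto_form_right = bounded_linear.tendsto[OF bounded_linear_form_right]
lemmas tendsto_form_left = bounded_linear.tendsto[OF bounded_linear_form_left]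

lemma form_definite: "ip x x = 0 \<Longrightarrow> x = 0"
  using norm_form_self[of x] by simp

lemma form_eqI: "(\<And>z. ip z x = ip z y) \<Longrightarrow> x = y"
  using form_definite[of "x - y"] by (simp add: form_diff_right)

text \<open>
  Adjointness as a relation composes with sums, products and limits without side conditions, and
  self-adjointness is its diagonal.
\<close>

definition adjoint_pair :: "'e endo \<Rightarrow> 'e endo \<Rightarrow> bool" where
  "adjoint_pair T S \<longleftrightarrow> (\<forall>x y. ip (app T x) y = ip x (app S y))"

definition Adj :: "'e endo set" where "Adj = {T. \<exists>S. adjoint_pair T S}"

definition ad :: "'e endo \<Rightarrow> 'e endo" where "ad T = (THE S. adjoint_pair T S)"

abbreviation sa :: "'e endo \<Rightarrow> bool" where "sa T \<equiv> adjoint_pair T T"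

lemma adjoint_pair_unique: "adjoint_pair T S \<Longrightarrow> adjoint_pair T S' \<Longrightarrow> S = S'"
  unfolding adjoint_pair_def by (intro endo_eqI form_eqI) metis

lemma adjoint_pair_sym: "adjoint_pair T S \<Longrightarrow> adjoint_pair S T"
  unfolding adjoint_pair_def by (metis form_star)

lemma ad_eqI: "adjoint_pair T S \<Longrightarrow> ad T = S"
  unfolding ad_def using adjoint_pair_unique by blast

lemma ad_pair: "T \<in> Adj \<Longrightarrow> adjoint_pair T (ad T)"
  using ad_eqI by (auto simp: Adj_def)

lemma AdjI: "adjoint_pair T S \<Longrightarrow> T \<in> Adj"
  by (auto simp: Adj_def)

lemma pair_0 [simp]: "sa 0" and pair_1 [simp]: "sa 1"
  by (simp_all add: adjoint_pair_def)

lemma pair_add: "adjoint_pair T S \<Longrightarrow> adjoint_pair T' S' \<Longrightarrow> adjoint_pair (T + T') (S + S')"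
  and pair_diff: "adjoint_pair T S \<Longrightarrow> adjoint_pair T' S' \<Longrightarrow> adjoint_pair (T - T') (S - S')"
  and pair_minus: "adjoint_pair T S \<Longrightarrow> adjoint_pair (- T) (- S)"
  and pair_scaleR: "adjoint_pair T S \<Longrightarrow> adjoint_pair (r *\<^sub>R T) (r *\<^sub>R S)"
  and pair_mult: "adjoint_pair T S \<Longrightarrow> adjoint_pair T' S' \<Longrightarrow> adjoint_pair (T * T') (S' * S)"
  and pair_scal: "adjoint_pair (scal c) (scal (cnj c))"
  by (simp_all add: adjoint_pair_def form_add_left form_add_right form_diff_left form_diff_right
      form_scaleC_left form_scaleC_right)

lemma sa_mult: "sa S \<Longrightarrow> sa T \<Longrightarrow> S * T = T * S \<Longrightarrow> sa (S * T)"
  using pair_mult[of S S T T] by simp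

lemma sa_power: "sa T \<Longrightarrow> sa (T ^ n)"
  by (induction n) (auto intro!: sa_mult simp: power_commutes)

lemma pair_sum: "(\<And>i. i \<in> I \<Longrightarrow> adjoint_pair (f i) (g i)) \<Longrightarrow>
    adjoint_pair (\<Sum>i\<in>I. f i) (\<Sum>i\<in>I. g i)"
  by (induction I rule: infinite_finite_induct) (auto intro: pair_add)

lemma Adj_1 [simp]: "1 \<in> Adj" and Adj_scal [simp]: "scal c \<in> Adj"
  by (rule AdjI, rule pair_1 pair_scal)+

lemma Adj_add: "S \<in> Adj \<Longrightarrow> T \<in> Adj \<Longrightarrow> S + T \<in> Adj"
  and Adj_diff: "S \<in> Adj \<Longrightarrow> T \<in> Adj \<Longrightarrow> S - T \<in> Adj"
  and Adj_minus: "T \<in> Adj \<Longrightarrow> - T \<in> Adj"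
  and Adj_mult: "S \<in> Adj \<Longrightarrow> T \<in> Adj \<Longrightarrow> S * T \<in> Adj"
  and Adj_scaleR: "T \<in> Adj \<Longrightarrow> r *\<^sub>R T \<in> Adj"
  by (rule AdjI, (rule pair_add pair_diff pair_minus pair_mult pair_scaleR; (rule ad_pair)?; assumption))+

text \<open>
  For \<open>y = S x\<close>, the square of \<open>norm y\<close> is the norm of \<open>ip (T y) x\<close>.
\<close>

lemma norm_pair_le: assumes "adjoint_pair T S" shows "norm S \<le> norm T"
proof (rule norm_endo_bound)
  fix x
  show "norm (app S x) \<le> norm T * norm x"
  proof (cases "app S x = 0")
    case False
    have "(norm (app S x))\<^sup>2 = norm (ip (app T (app S x)) x)"
      using assms by (simp add: adjoint_pair_def norm_form_self)
    also have "\<dots> \<le> norm (app T (app S x)) * norm x" by (rule cauchy_schwarz)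
    also have "\<dots> \<le> (norm T * norm (app S x)) * norm x" by (intro mult_right_mono app_norm) simp
    finally show ?thesis using False by (simp add: power2_eq_square)
  qed simp
qed simp

lemma norm_pair_eq: "adjoint_pair T S \<Longrightarrow> norm S = norm T"
  using norm_pair_le adjoint_pair_sym by (meson order_antisym)

text \<open>
  The square of \<open>norm (T x)\<close> is the norm of \<open>ip x (S (T x))\<close>, to which Cauchy-Schwarz applies.
\<close>

lemma operator_cstar_identity: assumes "adjoint_pair T S" shows "norm (S * T) = (norm T)\<^sup>2"
proof (rule antisym)
  show "norm (S * T) \<le> (norm T)\<^sup>2"
    using norm_mult_ineq[of S T] norm_pair_eq[OF assms] by (simp add: power2_eq_square)
  have "norm T \<le> sqrt (norm (S * T))"
  proof (rule norm_endo_bound)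
    fix x
    have "(norm (app T x))\<^sup>2 = norm (ip x (app (S * T) x))"
      using assms by (simp add: adjoint_pair_def norm_form_self[symmetric])
    also have "\<dots> \<le> norm x * (norm (S * T) * norm x)"
      by (rule order_trans[OF cauchy_schwarz]) (intro mult_left_mono app_norm norm_ge_zero)
    finally have "(norm (app T x))\<^sup>2 \<le> (sqrt (norm (S * T)) * norm x)\<^sup>2"
      by (simp add: power_mult_distrib power2_eq_square mult.commute mult.left_commute)
    then show "norm (app T x) \<le> sqrt (norm (S * T)) * norm x"
      by (rule power2_le_imp_le) simp
  qed simp
  then have "(norm T)\<^sup>2 \<le> (sqrt (norm (S * T)))\<^sup>2" by (intro power_mono) auto
  then show "(norm T)\<^sup>2 \<le> norm (S * T)" by simp
qed

lemma pair_limit: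
  assumes "X \<longlonglongrightarrow> T" "Y \<longlonglongrightarrow> S" "\<And>n. adjoint_pair (X n) (Y n)"
  shows "adjoint_pair T S"
  unfolding adjoint_pair_def
proof (intro allI)
  fix x y
  have "(\<lambda>n. ip (app (X n) x) y) \<longlonglongrightarrow> ip (app T x) y"
    by (intro tendsto_form_left tendsto_app assms)
  moreover have "(\<lambda>n. ip x (app (Y n) y)) \<longlonglongrightarrow> ip x (app S y)"
    by (intro tendsto_form_right tendsto_app assms)
  ultimately show "ip (app T x) y = ip x (app S y)"
    using assms(3) LIMSEQ_unique by (simp add: adjoint_pair_def)
qed

lemma sa_limit: "X \<longlonglongrightarrow> T \<Longrightarrow> (\<And>n. sa (X n)) \<Longrightarrow> sa T"
  by (rule pair_limit)

text \<open>
  The passage to adjoints is isometric, so the adjoints of a convergent sequence converge too.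
\<close>

lemma Adj_limit: assumes "X \<longlonglongrightarrow> T" "\<And>n. X n \<in> Adj" shows "T \<in> Adj"
proof -
  have "norm (ad (X m) - ad (X n)) = norm (X m - X n)" for m n
    by (rule norm_pair_eq, rule pair_diff; rule ad_pair[OF assms(2)])
  then have "Cauchy (\<lambda>n. ad (X n))"
    using LIMSEQ_imp_Cauchy[OF assms(1)] by (simp add: Cauchy_def dist_norm)
  then obtain S where "(\<lambda>n. ad (X n)) \<longlonglongrightarrow> S"
    using Cauchy_convergent_iff convergent_def by blast
  then show ?thesis using pair_limit[OF assms(1)] ad_pair[OF assms(2)] AdjI by blast
qed

end


section \<open>Positivity expressed by norms\<close>

context cstar_form
begin

lemma sqrt_one_minus_sa: assumes "sa x" "norm x \<le> 1" shows "sa (sqrt_one_minus x)"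
  using sqrt_one_minus_sums[OF assms(2)] unfolding sums_def
  by (rule sa_limit) (intro pair_sum pair_scaleR sa_power assms)

text \<open>
  The element \<open>n = h + \<i> k\<close> is normal with \<open>n\<^sup>* n = h\<^sup>2 + k\<^sup>2\<close>, so \<open>n\<close> and its adjoint have norm at
  most \<open>sqrt s\<close> by the C*-identity. Now \<open>h\<close> is the real part of \<open>n\<close>, and \<open>h\<^sup>2 - k\<^sup>2\<close> is the real
  part of \<open>n\<^sup>2\<close>. With square roots at hand this replaces the spectral radius formula.
\<close>

lemma commuting_squares_norm:
  assumes h: "sa h" and k: "sa k" and comm: "h * k = k * h"
    and sum: "h * h + k * k = s *\<^sub>R 1" and s: "s \<ge> 0"
  shows "norm (h * h) \<le> s" and "norm (h * h - k * k) \<le> s"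
proof -
  define J :: "'e endo" where "J = scal \<i>"
  define n where "n = h + J * k"
  define m where "m = h - J * k"
  have JJ: "J * (J * x) = - x" for x
    by (rule endo_eqI) (simp add: J_def scaleC_scaleC scaleR_scaleC[of "-1", simplified])
  have Jc: "x * J = J * x" for x
    unfolding J_def by (rule scal_commute[symmetric])
  have Jc': "x * (J * y) = J * (x * y)" for x y
    using arg_cong[OF Jc[of x], of "\<lambda>z. z * y"] by (simp only: mult.assoc)
  have "adjoint_pair n (h + k * scal (cnj \<i>))"
    unfolding n_def J_def by (intro pair_add h pair_mult k pair_scal)
  then have nm: "adjoint_pair n m"
    by (simp add: m_def J_def scal_minus scal_commute)
  have "m * n = s *\<^sub>R 1"
    unfolding sum[symmetric] by (simp add: m_def n_def algebra_simps Jc[of h] Jc'[of h] Jc[of k] Jc'[of k] JJ comm)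
  then have "(norm n)\<^sup>2 \<le> s"
    using operator_cstar_identity[OF nm] s mult_left_le[OF norm_endo_one_le[where 'e = 'e] s] by simp
  then have n: "norm n \<le> sqrt s" and m: "norm m \<le> sqrt s"
    using norm_pair_eq[OF nm] by (simp_all add: real_le_rsqrt)
  have prod: "norm (a * b) \<le> s" if "norm a \<le> sqrt s" "norm b \<le> sqrt s" for a b :: "'e endo"
  proof -
    have "norm (a * b) \<le> norm a * norm b" by (rule norm_mult_ineq)
    also have "\<dots> \<le> sqrt s * sqrt s" using that s by (intro mult_mono) auto
    finally show ?thesis using s by simp
  qed
  have "2 *\<^sub>R h = n + m" by (simp add: n_def m_def scaleR_2)
  then have "2 * norm h \<le> norm n + norm m" by (metis norm_scaleR norm_triangle_ineq abs_numeral)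
  with n m have "norm h \<le> sqrt s" by simp
  then show "norm (h * h) \<le> s" by (intro prod)
  have "2 *\<^sub>R (h * h - k * k) = n * n + m * m"
    by (simp add: n_def m_def algebra_simps scaleR_2 Jc[of h] Jc'[of h] Jc[of k] Jc'[of k] JJ)
  then have "2 * norm (h * h - k * k) \<le> norm (n * n) + norm (m * m)"
    by (metis norm_scaleR norm_triangle_ineq abs_numeral)
  with prod[OF n n] prod[OF m m] show "norm (h * h - k * k) \<le> s" by simp
qed

text \<open>
  After normalization to \<open>s = 1\<close>, the difference \<open>1 - S\<^sup>2\<close> is the square of a root \<open>k\<close> that commutes
  with \<open>S\<close>, and the squares of \<open>S\<close> and \<open>k\<close> add up to 1.
\<close>

lemma norm_minus_square:
  assumes S: "sa S" and le: "(norm S)\<^sup>2 \<le> s" shows "norm (s *\<^sub>R 1 - S * S) \<le> s"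
proof (cases "s = 0")
  case True
  with le show ?thesis by simp
next
  case False
  with le have s: "s > 0" by (smt (verit) zero_le_power2)
  define h where "h = (1 / sqrt s) *\<^sub>R S"
  define k where "k = sqrt_one_minus (h * h)"
  have h: "sa h" unfolding h_def by (intro pair_scaleR S)
  have hh: "h * h = (1 / s) *\<^sub>R (S * S)" using s by (simp add: h_def)
  have "norm (S * S) \<le> s" using norm_mult_ineq[of S S] le by (simp add: power2_eq_square)
  then have x: "norm (h * h) \<le> 1" unfolding hh using s by (simp add: field_simps)
  have kk: "k * k = 1 - h * h" unfolding k_def by (rule sqrt_one_minus_square[OF x])
  have "norm (k * k) \<le> 1"
  proof (rule commuting_squares_norm(1))
    show "sa k" unfolding k_def by (intro sqrt_one_minus_sa sa_mult h x refl)
    show "k * h = h * k"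
      unfolding k_def by (rule sqrt_one_minus_commute[OF x, symmetric]) (simp add: mult.assoc)
  qed (use h kk in simp_all)
  moreover have "s *\<^sub>R 1 - S * S = s *\<^sub>R (k * k)"
    unfolding kk hh using s by (simp add: scaleR_diff_right)
  ultimately show ?thesis using s by (simp add: mult_left_le)
qed

text \<open>
  Positivity, formulated so that it is visibly preserved by sums and visibly gives a square root:
  \<open>T = s (1 - x)\<close> with \<open>x\<close> in the unit ball.
\<close>

definition psd :: "'e endo \<Rightarrow> bool" where
  "psd T \<longleftrightarrow> sa T \<and> (\<exists>s\<ge>0. norm (s *\<^sub>R 1 - T) \<le> s)"

lemma psd_sa: "psd T \<Longrightarrow> sa T"
  by (simp add: psd_def)

lemma psd_add: assumes "psd S" "psd T" shows "psd (S + T)"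
proof -
  from assms obtain s t where st: "s \<ge> 0" "t \<ge> 0" "norm (s *\<^sub>R 1 - S) \<le> s" "norm (t *\<^sub>R 1 - T) \<le> t"
    by (auto simp: psd_def)
  have "(s + t) *\<^sub>R 1 - (S + T) = (s *\<^sub>R 1 - S) + (t *\<^sub>R 1 - T)"
    by (simp add: algebra_simps)
  then have "norm ((s + t) *\<^sub>R 1 - (S + T)) \<le> s + t"
    using st norm_triangle_ineq[of "s *\<^sub>R 1 - S" "t *\<^sub>R 1 - T"] by (metis add_mono order_trans)
  moreover have "sa (S + T)" using assms by (intro pair_add psd_sa)
  ultimately show ?thesis using st unfolding psd_def by (intro conjI exI[of _ "s + t"]) simp_all
qed

lemma psd_norm_minus: assumes "sa T" "norm T \<le> s" shows "psd (s *\<^sub>R 1 - T)"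
proof -
  have "s \<ge> 0" using assms(2) norm_ge_zero[of T] by linarith
  moreover have "sa (s *\<^sub>R 1 - T)" by (intro pair_diff pair_scaleR pair_1 assms)
  ultimately show ?thesis using assms(2) unfolding psd_def by (intro conjI exI[of _ s]) simp_all
qed

lemma psd_sqrt:
  assumes "psd T"
  obtains S where "sa S" "S * S = T" "\<And>z. z * T = T * z \<Longrightarrow> z * S = S * z"
proof -
  from assms obtain s where T: "sa T" and s: "s \<ge> 0" "norm (s *\<^sub>R 1 - T) \<le> s"
    by (auto simp: psd_def)
  show ?thesis
  proof (cases "s = 0")
    case True
    with s have "T = 0" by simp
    then show ?thesis by (intro that[of 0]) simp_all
  next
    case False
    with s have s0: "s > 0" by simp
    define x where "x = 1 - (1 / s) *\<^sub>R T"
    have sx: "s *\<^sub>R x = s *\<^sub>R 1 - T" using s0 by (simp add: x_def scaleR_diff_right)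
    have x: "norm x \<le> 1" using s(2) s0 unfolding sx[symmetric] by simp
    have sax: "sa x" unfolding x_def by (intro pair_diff pair_scaleR pair_1 T)
    show ?thesis
    proof (rule that[of "sqrt s *\<^sub>R sqrt_one_minus x"])
      show "sa (sqrt s *\<^sub>R sqrt_one_minus x)" by (intro pair_scaleR sqrt_one_minus_sa sax x)
      show "sqrt s *\<^sub>R sqrt_one_minus x * sqrt s *\<^sub>R sqrt_one_minus x = T"
        using s0 by (simp add: sqrt_one_minus_square[OF x]) (simp add: x_def)
      show "z * sqrt s *\<^sub>R sqrt_one_minus x = sqrt s *\<^sub>R sqrt_one_minus x * z"
        if "z * T = T * z" for z
        using sqrt_one_minus_commute[OF x, of z] that by (simp add: x_def algebra_simps)
    qed
  qed
qed

text \<open>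
  Roots \<open>h\<close> of \<open>s + q\<close> and \<open>k\<close> of \<open>s - q\<close> commute, since each of them commutes with whatever
  commutes with \<open>q\<close>; and \<open>h\<^sup>2 + k\<^sup>2 = 2 s\<close>, \<open>h\<^sup>2 - k\<^sup>2 = 2 q\<close>.
\<close>

lemma psd_sandwich_norm:
  assumes "psd (s *\<^sub>R 1 - q)" "psd (s *\<^sub>R 1 + q)" "s \<ge> 0"
  shows "norm q \<le> s"
proof -
  obtain h where h: "sa h" "h * h = s *\<^sub>R 1 + q"
    "\<And>z. z * (s *\<^sub>R 1 + q) = (s *\<^sub>R 1 + q) * z \<Longrightarrow> z * h = h * z"
    using psd_sqrt[OF assms(2)] by blast
  obtain k where k: "sa k" "k * k = s *\<^sub>R 1 - q"
    "\<And>z. z * (s *\<^sub>R 1 - q) = (s *\<^sub>R 1 - q) * z \<Longrightarrow> z * k = k * z"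
    using psd_sqrt[OF assms(1)] by blast
  have "q * k = k * q" by (rule k(3)) (simp add: algebra_simps)
  then have "k * h = h * k" by (intro h(3)) (simp add: algebra_simps)
  moreover have "h * h + k * k = (2 * s) *\<^sub>R 1"
    unfolding h(2) k(2) by (simp add: scaleR_2[symmetric])
  ultimately have "norm (h * h - k * k) \<le> 2 * s"
    using h(1) k(1) assms(3) by (intro commuting_squares_norm(2)) simp_all
  moreover have "h * h - k * k = 2 *\<^sub>R q" unfolding h(2) k(2) by (simp add: scaleR_2)
  ultimately show ?thesis by simp
qed

section \<open>The spectrum of a self-adjoint operator\<close>

definition inv_in :: "'e endo \<Rightarrow> bool" where
  "inv_in T \<longleftrightarrow> (\<exists>S\<in>Adj. S * T = 1 \<and> T * S = 1)"

definition spec :: "'e endo \<Rightarrow> complex set" where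
  "spec T = {z. \<not> inv_in (scal z - T)}"

lemma inv_inI: "R \<in> Adj \<Longrightarrow> L * T = 1 \<Longrightarrow> T * R = 1 \<Longrightarrow> inv_in T"
  unfolding inv_in_def by (metis mult.assoc mult_1_left mult_1_right)

lemma inv_in_mult: assumes "inv_in S" "inv_in T" shows "inv_in (S * T)"
proof -
  from assms obtain S' T' where "S' \<in> Adj" "S' * S = 1" "S * S' = 1" "T' \<in> Adj" "T' * T = 1" "T * T' = 1"
    by (auto simp: inv_in_def)
  then have "T' * S' \<in> Adj" "T' * S' * (S * T) = 1" "S * T * (T' * S') = 1"
    by (simp_all add: Adj_mult mult.assoc) (simp_all add: mult.assoc[symmetric])
  then show ?thesis unfolding inv_in_def by blast
qed

text \<open>
  If \<open>V\<close> inverts \<open>S T = T S\<close> then \<open>V T\<close> is a left and \<open>T V\<close> a right inverse of \<open>S\<close>.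
\<close>

lemma inv_in_factor:
  assumes "inv_in (S * T)" "S * T = T * S" "T \<in> Adj" shows "inv_in S"
proof -
  from assms obtain V where V: "V \<in> Adj" "V * (S * T) = 1" "S * T * V = 1"
    by (auto simp: inv_in_def)
  show ?thesis
  proof (rule inv_inI)
    show "T * V \<in> Adj" by (intro Adj_mult V assms)
    show "(V * T) * S = 1" using V(2) assms(2) by (simp add: mult.assoc)
    show "S * (T * V) = 1" using V(3) by (simp add: mult.assoc)
  qed
qed

lemma inv_in_scaleR: assumes "inv_in T" "r \<noteq> 0" shows "inv_in (r *\<^sub>R T)"
proof -
  from assms obtain S where "S \<in> Adj" "S * T = 1" "T * S = 1" by (auto simp: inv_in_def)
  then show ?thesis using assms(2)
    by (intro inv_inI[of "(1 / r) *\<^sub>R S" "(1 / r) *\<^sub>R S"]) (simp_all add: Adj_scaleR)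
qed

lemma neumann: assumes x: "x \<in> Adj" "norm x < 1" shows "inv_in (1 - x)"
proof -
  have "summable (\<lambda>n. norm (x ^ n))"
  proof (rule summable_comparison_test')
    show "summable (\<lambda>n. norm x ^ n)" using x(2) by (simp add: summable_geometric)
  qed (use norm_endo_power_le in auto)
  then have "summable (\<lambda>n. x ^ n)" by (rule summable_norm_cancel)
  then obtain S where S: "(\<lambda>n. x ^ n) sums S" by (auto simp: summable_def)
  have pow: "x ^ n \<in> Adj" for n by (induction n) (auto intro: Adj_mult x)
  have part: "(\<Sum>i<n. x ^ i) \<in> Adj" for n
    by (induction n) (auto intro: Adj_add pow AdjI[OF pair_0])
  have SA: "S \<in> Adj" by (rule Adj_limit[OF S[unfolded sums_def] part])
  have 1: "(\<lambda>n. x ^ Suc n) sums (S - 1)" using S by (subst sums_Suc_iff) simp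
  moreover have "(\<lambda>n. x ^ Suc n) sums (x * S)"
    using sums_mult[OF S, of x] by simp
  moreover have "(\<lambda>n. x ^ Suc n) sums (S * x)"
    using sums_mult2[OF S, of x] by (simp add: power_commutes)
  ultimately have "x * S = S - 1" "S * x = S - 1" using sums_unique2 by blast+
  then show ?thesis using SA by (intro inv_inI[of S S]) (simp_all add: algebra_simps)
qed

lemma inv_in_perturb:
  assumes S: "S \<in> Adj" "S * T = 1" "T * S = 1" and V: "V \<in> Adj" "norm S * norm V < 1"
  shows "inv_in (T + V)"
proof -
  have "norm (- (S * V)) < 1" using V(2) norm_mult_ineq[of S V] by simp
  then have "inv_in (1 - - (S * V))" by (intro neumann Adj_minus Adj_mult S V)
  then obtain W where W: "W \<in> Adj" "W * (1 + S * V) = 1" "(1 + S * V) * W = 1"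
    by (auto simp: inv_in_def)
  have TV: "T + V = T * (1 + S * V)"
    using S(3) by (simp add: distrib_left mult.assoc[symmetric])
  show ?thesis
  proof (rule inv_inI)
    show "W * S \<in> Adj" by (intro Adj_mult W S)
    show "(W * S) * (T + V) = 1"
      unfolding TV using W(2) S(2) by (simp add: mult.assoc) (simp add: mult.assoc[symmetric])
    show "(T + V) * (W * S) = 1"
      unfolding TV using W(3) S(3) by (simp add: mult.assoc) (simp add: mult.assoc[symmetric])
  qed
qed

lemma inv_in_norm_less: assumes "T \<in> Adj" "norm T < \<bar>r\<bar>" shows "inv_in (r *\<^sub>R 1 - T)"
proof -
  have r: "r \<noteq> 0" using assms(2) by auto
  have "inv_in (1 - (1 / r) *\<^sub>R T)"
    using assms r by (intro neumann Adj_scaleR) (simp_all add: divide_less_eq)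
  then have "inv_in (r *\<^sub>R (1 - (1 / r) *\<^sub>R T))" using r by (rule inv_in_scaleR)
  then show ?thesis using r by (simp add: scaleR_diff_right)
qed

text \<open>
  If neither \<open>1\<close> nor \<open>-1\<close> were in the spectrum, \<open>1 - d\<^sup>2 = c\<^sup>2\<close> would have an inverse \<open>e = (c e)\<^sup>2\<close>.
  As \<open>e\<close> is bounded, \<open>c\<^sup>2\<close> stays away from 0: \<open>c\<^sup>2 - \<delta>\<close> is a square \<open>k\<^sup>2\<close> for some \<open>\<delta> > 0\<close>. Then
  \<open>d\<^sup>2 + k\<^sup>2 = 1 - \<delta>\<close> makes the norm of \<open>d\<close> smaller than 1.
\<close>

lemma norm_in_spec_aux:
  assumes d: "sa d" and norm_d: "norm d = 1"
  shows "\<not> inv_in (1 - d) \<or> \<not> inv_in (- 1 - d)"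
proof (rule ccontr)
  assume "\<not> ?thesis"
  then have "inv_in ((1 - d) * - (- 1 - d))"
    using inv_in_scaleR[of "- 1 - d" "-1"] by (intro inv_in_mult) simp_all
  then have "inv_in (1 - d * d)" by (simp add: algebra_simps)
  then obtain e where e: "e * (1 - d * d) = 1" "(1 - d * d) * e = 1" "e \<in> Adj"
    by (auto simp: inv_in_def)
  have x: "norm (d * d) \<le> 1" using norm_mult_ineq[of d d] norm_d by simp
  have sad: "sa (d * d)" by (intro sa_mult d refl)
  define c where "c = sqrt_one_minus (d * d)"
  have c: "sa c" "c * c = 1 - d * d"
    unfolding c_def by (intro sqrt_one_minus_sa sad x, intro sqrt_one_minus_square x)
  have ccomm: "z * c = c * z" if "z * (d * d) = (d * d) * z" for z
    unfolding c_def by (intro sqrt_one_minus_commute x that)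
  have "sa (1 - d * d)" by (intro pair_diff pair_1 sad)
  then have "adjoint_pair (e * (1 - d * d)) ((1 - d * d) * ad e)"
    using ad_pair[OF e(3)] by (rule pair_mult[rotated])
  then have "(1 - d * d) * ad e = 1"
    unfolding e(1) using adjoint_pair_unique[OF pair_1] by simp
  then have "ad e = e" using e(1) by (metis mult.assoc mult_1_left mult_1_right)
  then have sae: "sa e" using ad_pair[OF e(3)] by simp
  have "e * (1 - d * d) = (1 - d * d) * e" using e(1,2) by simp
  then have "e * (d * d) = (d * d) * e" by (simp only: left_diff_distrib right_diff_distrib) simp
  then have ec: "e * c = c * e" by (rule ccomm)
  \<comment> \<open>f is a root of (norm e + 1) - e; the added 1 keeps delta positive and at most 1\<close>
  have "psd ((norm e + 1) *\<^sub>R 1 - e)" by (intro psd_norm_minus sae) simp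
  then obtain f where f: "sa f" "f * f = (norm e + 1) *\<^sub>R 1 - e"
    "\<And>z. z * ((norm e + 1) *\<^sub>R 1 - e) = ((norm e + 1) *\<^sub>R 1 - e) * z \<Longrightarrow> z * f = f * z"
    using psd_sqrt by blast
  define \<delta> where "\<delta> = 1 / (norm e + 1)"
  have \<delta>: "\<delta> > 0" "\<delta> \<le> 1" "\<delta> * (norm e + 1) = 1"
    using norm_ge_zero[of e] by (simp_all add: \<delta>_def field_simps del: norm_ge_zero)
  have cf: "c * f = f * c" using ec by (intro f(3)) (simp add: algebra_simps)
  have df: "d * f = f * d"
  proof (rule f(3))
    have "(d * e) * (1 - d * d) = d" "e * ((1 - d * d) * d) = d"
      using e by (simp_all add: mult.assoc) (simp_all add: mult.assoc[symmetric])
    moreover have "(1 - d * d) * d = d * (1 - d * d)" by (simp add: algebra_simps)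
    ultimately have "(d * e) * (1 - d * d) = (e * d) * (1 - d * d)" by (simp add: mult.assoc)
    then have "(d * e) * ((1 - d * d) * e) = (e * d) * ((1 - d * d) * e)" by (metis mult.assoc)
    then have "d * e = e * d" unfolding e(2) by simp
    then show "d * ((norm e + 1) *\<^sub>R 1 - e) = ((norm e + 1) *\<^sub>R 1 - e) * d"
      by (simp add: algebra_simps)
  qed
  have dc: "d * c = c * d" by (rule ccomm) (simp add: mult.assoc)
  define k where "k = sqrt \<delta> *\<^sub>R (c * f)"
  have "k * k = \<delta> *\<^sub>R ((c * c) * (f * f))"
    using \<delta> by (simp add: k_def) (metis cf mult.assoc)
  also have "\<dots> = (c * c) * (\<delta> *\<^sub>R (norm e + 1) *\<^sub>R 1 - \<delta> *\<^sub>R e)"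
    unfolding f(2) by (simp add: right_diff_distrib scaleR_diff_right)
  also have "\<dots> = c * c - \<delta> *\<^sub>R 1"
    using \<delta>(3) e(2) unfolding c(2) scaleR_scaleR by (simp add: right_diff_distrib)
  finally have "d * d + k * k = (1 - \<delta>) *\<^sub>R 1"
    unfolding c(2) by (simp add: algebra_simps)
  moreover have "sa k" unfolding k_def by (intro pair_scaleR sa_mult c f cf)
  moreover have "d * k = k * d"
    unfolding k_def using dc df by (simp add: mult.assoc) (metis mult.assoc)
  ultimately have "norm (d * d) \<le> 1 - \<delta>"
    using d \<delta> by (intro commuting_squares_norm(1)) auto
  then show False using operator_cstar_identity[OF d] norm_d \<delta>(1) by simp
qed

lemma norm_in_spec:
  assumes d: "sa d" "d \<noteq> 0"
  shows "\<not> inv_in (norm d *\<^sub>R 1 - d) \<or> \<not> inv_in (- norm d *\<^sub>R 1 - d)"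
proof -
  define m where "m = norm d"
  have m: "m > 0" using d(2) by (simp add: m_def)
  define d' where "d' = (1 / m) *\<^sub>R d"
  have "sa d'" "norm d' = 1" using m by (simp_all add: d'_def pair_scaleR d) (simp add: m_def)
  then have "\<not> inv_in (1 - d') \<or> \<not> inv_in (- 1 - d')" by (rule norm_in_spec_aux)
  moreover have "1 - d' = (1 / m) *\<^sub>R (m *\<^sub>R 1 - d)" "- 1 - d' = (1 / m) *\<^sub>R (- m *\<^sub>R 1 - d)"
    using m by (simp_all add: d'_def scaleR_diff_right)
  ultimately show ?thesis using inv_in_scaleR m unfolding m_def[symmetric] by fastforce
qed

text \<open>
  With \<open>s = norm T\<close>, the norm of \<open>s - T\<close> is, up to sign, a spectral value of \<open>s - T\<close>. If it were
  larger than \<open>s\<close>, then \<open>T\<close> would have either a negative spectral value or one beyond its norm.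
\<close>

lemma psd_if_spec_nonneg:
  assumes T: "sa T" and spec: "\<And>r. r < 0 \<Longrightarrow> inv_in (r *\<^sub>R 1 - T)"
  shows "psd T"
proof -
  define s where "s = norm T"
  define d where "d = s *\<^sub>R 1 - T"
  have d: "sa d" unfolding d_def by (intro pair_diff pair_scaleR pair_1 T)
  have "norm d \<le> s"
  proof (rule ccontr)
    assume "\<not> norm d \<le> s"
    then have less: "s < norm d" by simp
    moreover have s0: "s \<ge> 0" by (simp add: s_def)
    ultimately have "d \<noteq> 0" by auto
    from norm_in_spec[OF d this] show False
    proof
      assume "\<not> inv_in (norm d *\<^sub>R 1 - d)"
      moreover have "norm d *\<^sub>R 1 - d = (-1) *\<^sub>R ((s - norm d) *\<^sub>R 1 - T)"
        unfolding d_def[symmetric] by (simp add: d_def algebra_simps)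
      moreover have "inv_in ((s - norm d) *\<^sub>R 1 - T)" using less by (intro spec) simp
      ultimately show False using inv_in_scaleR by (metis zero_neq_neg_one)
    next
      assume "\<not> inv_in (- norm d *\<^sub>R 1 - d)"
      moreover have "- norm d *\<^sub>R 1 - d = (-1) *\<^sub>R ((s + norm d) *\<^sub>R 1 - T)"
        by (simp add: d_def algebra_simps)
      moreover have "inv_in ((s + norm d) *\<^sub>R 1 - T)"
        by (rule inv_in_norm_less[OF AdjI[OF T]]) (use less s0 s_def in linarith)
      ultimately show False using inv_in_scaleR by (metis zero_neq_neg_one)
    qed
  qed
  then show ?thesis using T unfolding psd_def d_def by (auto simp: s_def intro!: exI[of _ s])
qed

text \<open>
  Let \<open>S = T - Re z\<close> and \<open>b = Im z\<close>. In \<open>S\<^sup>2 + b\<^sup>2 = (s + b\<^sup>2) - (s - S\<^sup>2)\<close> with \<open>s\<close> the square of the norm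
  of \<open>S\<close>, the last term has norm at most \<open>s\<close>, so the sum is invertible by a Neumann series; and it
  factors into \<open>S - \<i> b\<close> and \<open>S + \<i> b\<close>.
\<close>

lemma sa_nonreal_inv:
  assumes T: "sa T" and z: "Im z \<noteq> 0" shows "inv_in (scal z - T)"
proof -
  define S where "S = T - Re z *\<^sub>R 1"
  define b where "b = Im z"
  define J :: "'e endo" where "J = scal (\<i> * b)"
  have S: "sa S" unfolding S_def by (intro pair_diff pair_scaleR pair_1 T)
  have J: "J \<in> Adj" by (simp add: J_def)
  have JS: "J * S = S * J" by (simp add: J_def scal_commute)
  have JJ: "J * J = (- (b\<^sup>2)) *\<^sub>R 1"
  proof -
    have "\<i> * complex_of_real b * (\<i> * complex_of_real b) = complex_of_real (- (b\<^sup>2))"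
      by (simp add: complex_eq_iff power2_eq_square)
    then show ?thesis unfolding J_def scal_mult[symmetric] by (simp only: scal_of_real)
  qed
  have zT: "scal z - T = J - S"
    unfolding J_def S_def b_def scal_of_real[symmetric]
    by (subst complex_eq[of z]) (simp add: scal_add)
  have "norm ((norm S)\<^sup>2 *\<^sub>R 1 - S * S) < \<bar>(norm S)\<^sup>2 + b\<^sup>2\<bar>"
    using norm_minus_square[OF S order_refl] zero_less_power2[of b] z unfolding b_def by linarith
  then have "inv_in (((norm S)\<^sup>2 + b\<^sup>2) *\<^sub>R 1 - ((norm S)\<^sup>2 *\<^sub>R 1 - S * S))"
    by (intro inv_in_norm_less AdjI[OF pair_diff[OF pair_scaleR[OF pair_1] sa_mult[OF S S refl]]])
  also have "((norm S)\<^sup>2 + b\<^sup>2) *\<^sub>R 1 - ((norm S)\<^sup>2 *\<^sub>R 1 - S * S) = (J - S) * (- J - S)"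
    using JJ JS by (simp add: algebra_simps)
  finally have prod: "inv_in ((J - S) * (- J - S))" .
  show ?thesis
    unfolding zT
  proof (rule inv_in_factor[OF prod])
    show "(J - S) * (- J - S) = (- J - S) * (J - S)" using JS by (simp add: algebra_simps)
    show "- J - S \<in> Adj" by (intro Adj_diff Adj_minus J AdjI[OF S])
  qed
qed

text \<open>
  Off the real axis \<open>B - \<i> t\<close> is invertible, and for small \<open>t\<close> its inverse is bounded independently of
  \<open>t\<close>, because \<open>B\<close> is bounded below. So \<open>B\<close> is a perturbation of \<open>B - \<i> t\<close> within the radius of
  invertibility.
\<close>

lemma sa_bounded_below_inv:
  assumes B: "sa B" and c: "c > 0" and below: "\<And>x. norm (app B x) \<ge> c * norm x"
  shows "inv_in B"
proof -
  \<comment> \<open>t = c / 4 leaves the lower bound 3/4 c, hence an inverse of norm at most 2 / c\<close>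
  define V :: "'e endo" where "V = scal (\<i> * complex_of_real (c / 4))"
  have V: "V \<in> Adj" by (simp add: V_def)
  have nV: "norm V \<le> c / 4" using norm_scal_le[of "\<i> * complex_of_real (c / 4)"] c by (simp add: V_def norm_mult)
  have "inv_in (scal (- (\<i> * complex_of_real (c / 4))) - (- B))"
    by (rule sa_nonreal_inv) (use c B in \<open>auto intro: pair_minus\<close>)
  then have "inv_in (B - V)" by (simp add: V_def scal_minus)
  then obtain S where S: "S \<in> Adj" "S * (B - V) = 1" "(B - V) * S = 1" by (auto simp: inv_in_def)
  have "norm S \<le> 2 / c"
  proof (rule norm_endo_bound)
    fix x
    have "norm (app B (app S x)) \<le> norm (app ((B - V) * S) x) + norm (app V (app S x))"
      using norm_triangle_ineq[of "app ((B - V) * S) x" "app V (app S x)"] by simp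
    also have "\<dots> \<le> norm x + c / 4 * norm (app S x)"
      unfolding S(3) using order_trans[OF app_norm mult_right_mono[OF nV]] by simp
    finally have "c * norm (app S x) \<le> norm x + c / 4 * norm (app S x)"
      using below[of "app S x"] by linarith
    moreover have "c / 4 * norm (app S x) = (c * norm (app S x)) / 4" by simp
    ultimately have "c * norm (app S x) \<le> 2 * norm x"
      using norm_ge_zero[of x] by linarith
    then show "norm (app S x) \<le> 2 / c * norm x" using c by (simp add: field_simps)
  qed (use c in simp)
  then have "norm S * norm V \<le> 2 / c * (c / 4)" using nV c by (intro mult_mono) auto
  also have "\<dots> < 1" using c by simp
  finally have "inv_in ((B - V) + V)" by (intro inv_in_perturb[OF S V])
  then show ?thesis by simp
qed

end


section \<open>The order of a C*-algebra and the Cauchy-Schwarz inequality\<close>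

text \<open>
  A C*-algebra as a module over itself. The left multiplications and the scalars are among the
  adjointable operators of this form, so the unitization acts by adjointable operators.
\<close>

interpretation algebra: cstar_form "\<lambda>x y::'a::cstar_algebra. star x * y"
proof
  fix x y z :: 'a and c
  show "star x * (y + z) = star x * y + star x * z" by (rule distrib_left)
  show "star x * c *\<^sub>C y = c *\<^sub>C (star x * y)" by (rule mult_scaleC_right)
  show "star (star x * y) = star y * x" by (simp add: star_mult star_star)
  show "norm (star x * x) = (norm x)\<^sup>2" by (rule cstar_identity)
  show "norm (star x * y) \<le> norm x * norm y" using norm_mult_ineq[of "star x" y] by simp
qed

lift_definition left_mult :: "'a::cstar_algebra \<Rightarrow> 'a endo" is "\<lambda>a x. a * x"
  by (simp add: bounded_linear_mult_right mult_scaleC_right)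

lemma app_left_mult [simp]: "app (left_mult a) x = a * x"
  by transfer simp

lemma left_mult_add: "left_mult (a + b) = left_mult a + left_mult b"
  and left_mult_diff: "left_mult (a - b) = left_mult a - left_mult b"
  by (rule endo_eqI, simp add: algebra_simps)+

lemma left_mult_pair: "algebra.adjoint_pair (left_mult a) (left_mult (star a))"
  by (simp add: algebra.adjoint_pair_def star_mult mult.assoc)

text \<open>
  The norm is attained at \<open>star a\<close>, by the C*-identity.
\<close>

lemma norm_left_mult: "norm (left_mult a) = norm a"
proof (rule antisym)
  show "norm (left_mult a) \<le> norm a" by (rule norm_endo_bound) (simp_all add: norm_mult_ineq)
  have "(norm a)\<^sup>2 = norm (app (left_mult a) (star a))"
    using cstar_identity[of "star a"] by (simp add: star_star)
  also have "\<dots> \<le> norm (left_mult a) * norm a" using app_norm[of "left_mult a" "star a"] by simp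
  finally show "norm a \<le> norm (left_mult a)"
    by (cases "a = 0") (simp_all add: power2_eq_square)
qed

text \<open>
  An inverse \<open>b + w 1\<close> in the unitization acts as an adjointable inverse operator, so left
  multiplication by \<open>a\<close> has no negative spectrum.
\<close>

lemma cstar_positive_psd: assumes "cstar_positive a" shows "algebra.psd (left_mult a)"
proof (rule algebra.psd_if_spec_nonneg)
  show "algebra.sa (left_mult a)"
    using left_mult_pair[of a] assms by (simp add: cstar_positive_def)
  fix r :: real assume "r < 0"
  then have "complex_of_real r \<notin> cstar_spectrum a"
    using assms by (auto simp: cstar_positive_def)
  then obtain b w where w: "complex_of_real r * w = 1"
    and b1: "complex_of_real r *\<^sub>C b - w *\<^sub>C a - a * b = 0"
    and b2: "complex_of_real r *\<^sub>C b - w *\<^sub>C a - b * a = 0"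
    unfolding cstar_spectrum_def by auto
  have b1': "r *\<^sub>R b = w *\<^sub>C a + a * b" and b2': "r *\<^sub>R b = w *\<^sub>C a + b * a"
    using b1 b2 by (simp_all add: scaleR_scaleC algebra_simps)
  have w': "w *\<^sub>C r *\<^sub>R x = x" for x :: 'a
    using w by (simp add: scaleR_scaleC scaleC_scaleC mult.commute)
  then have w'': "r *\<^sub>R w *\<^sub>C x = x" for x :: 'a
    by (simp add: scaleC_scaleR_commute)
  let ?S = "left_mult b + scal w"
  have "?S \<in> algebra.Adj"
    by (intro algebra.Adj_add algebra.Adj_scal algebra.AdjI[OF left_mult_pair])
  moreover have "?S * (r *\<^sub>R 1 - left_mult a) = 1"
  proof (rule endo_eqI)
    fix x
    have "b * r *\<^sub>R x = (w *\<^sub>C a + b * a) * x" unfolding b2'[symmetric] by simp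
    then show "app (?S * (r *\<^sub>R 1 - left_mult a)) x = app 1 x"
      by (simp add: scaleC_diff w' w'' mult_scaleC_left algebra_simps)
  qed
  moreover have "(r *\<^sub>R 1 - left_mult a) * ?S = 1"
  proof (rule endo_eqI)
    fix x
    have "r *\<^sub>R b * x = (w *\<^sub>C a + a * b) * x" unfolding b1' by simp
    then show "app ((r *\<^sub>R 1 - left_mult a) * ?S) x = app 1 x"
      by (simp add: scaleC_diff w'' mult_scaleC_left mult_scaleC_right algebra_simps)
  qed
  ultimately show "algebra.inv_in (r *\<^sub>R 1 - left_mult a)" by (auto simp: algebra.inv_in_def)
qed

lemma psd_sandwich:
  assumes "algebra.psd (left_mult (p - q))" "algebra.psd (left_mult (p + q))"
    and "algebra.sa (left_mult p)"
  shows "norm q \<le> norm p"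
proof -
  have "algebra.psd (norm p *\<^sub>R 1 - left_mult p)"
    by (intro algebra.psd_norm_minus assms) (simp add: norm_left_mult)
  then have "algebra.psd ((norm p *\<^sub>R 1 - left_mult p) + left_mult (p - q))"
    and "algebra.psd ((norm p *\<^sub>R 1 - left_mult p) + left_mult (p + q))"
    by (intro algebra.psd_add assms; assumption)+
  then have "norm (left_mult q) \<le> norm p"
    by (intro algebra.psd_sandwich_norm) (simp_all add: left_mult_add left_mult_diff)
  then show ?thesis by (simp add: norm_left_mult)
qed

lemma cstar_positive_norm_mono:
  assumes "cstar_positive a" "cstar_positive b" shows "norm a \<le> norm (a + b)"
proof (rule psd_sandwich)
  note psd = cstar_positive_psd[OF assms(1)] cstar_positive_psd[OF assms(2)]
  show "algebra.psd (left_mult (a + b - a))" using psd by simp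
  show "algebra.psd (left_mult (a + b + a))"
    unfolding left_mult_add by (intro algebra.psd_add psd)
  show "algebra.sa (left_mult (a + b))"
    unfolding left_mult_add by (intro algebra.psd_sa algebra.psd_add psd)
qed

context hilbert_cstar_module
begin

lemma norm_ip_self: "norm (ip x x) = (norm x)\<^sup>2"
  by (simp add: norm_eq_sqrt_ip)

lemma ip_add_left: "ip (x + y) z = ip x z + ip y z"
  by (metis ip_add_right ip_star star_add)

lemma ip_act_left: "ip (act x a) y = star a * ip x y"
  by (metis ip_act_right ip_star star_mult)

lemma norm_act_le: "norm (act x a) \<le> norm x * norm a"
proof -
  have "(norm (act x a))\<^sup>2 = norm (star a * ip x x * a)"
    by (simp add: norm_ip_self[symmetric] ip_act_left ip_act_right mult.assoc)
  also have "\<dots> \<le> norm a * (norm x)\<^sup>2 * norm a"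
    by (rule order_trans[OF norm_mult_ineq], rule mult_right_mono,
        rule order_trans[OF norm_mult_ineq]) (simp_all add: norm_ip_self)
  also have "\<dots> = (norm x * norm a)\<^sup>2" by (simp add: power2_eq_square)
  finally show ?thesis by (rule power2_le_imp_le) simp
qed

text \<open>
  The usual proof relies on positivity of \<open>star c * c\<close> in an abstract C*-algebra. It is avoided here:
  the inner squares of \<open>y + u\<close> and \<open>y - u\<close> are positive, which sandwiches \<open>ip y u + ip u y\<close> between
  \<open>- (ip y y + ip u u)\<close> and \<open>ip y y + ip u u\<close> and bounds its norm. For \<open>u = x (t c)\<close> with \<open>c = ip x y\<close>
  and \<open>t\<close> the inverse square of \<open>norm x\<close>, the sandwiched element is \<open>2 t (star c * c)\<close>, of norm
  \<open>2 t (norm c)\<^sup>2\<close>, while the bound is at most \<open>(norm y)\<^sup>2 + t (norm c)\<^sup>2\<close>.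
\<close>

lemma norm_ip_le: "norm (ip x y) \<le> norm x * norm y"
proof (cases "x = 0")
  case True
  then show ?thesis using ip_add_left[of 0 0 y] by simp
next
  case False
  define t where "t = 1 / (norm x)\<^sup>2"
  have t: "t > 0" "t * (norm x)\<^sup>2 = 1" using False by (simp_all add: t_def)
  define c where "c = ip x y"
  define u where "u = act x (t *\<^sub>R c)"
  define p where "p = ip y y + ip u u"
  define q where "q = ip y u + ip u y"
  have ipyx: "ip y x = star c" by (simp add: c_def ip_star)
  have q: "q = (2 * t) *\<^sub>R (star c * c)"
    unfolding q_def u_def ip_act_left ip_act_right ipyx c_def[symmetric] star_scaleR
    by (simp add: scaleR_2 scaleR_add_left[symmetric])
  have ip_minus: "ip x (- y) = - ip x y" "ip (- x) y = - ip x y" for x y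
  proof -
    show 1: "ip x (- y) = - ip x y" for x y
      using ip_scaleC_right[of x "-1" y] scaleC_of_real[of "-1" y] scaleC_of_real[of "-1" "ip x y"] by simp
    show "ip (- x) y = - ip x y"
      using 1[of y x] by (metis ip_star star_minus)
  qed
  have "cstar_positive (ip (y + u) (y + u))" "cstar_positive (ip (y + - u) (y + - u))"
    by (rule ip_positive)+
  then have pos: "cstar_positive (p + q)" "cstar_positive (p - q)"
    by (simp_all only: ip_add_left ip_add_right ip_minus p_def q_def) (simp_all add: algebra_simps)
  have "cstar_positive (ip y y)" "cstar_positive (ip u u)" by (rule ip_positive)+
  then have "algebra.psd (left_mult p)"
    unfolding p_def left_mult_add by (intro algebra.psd_add cstar_positive_psd)
  then have "norm q \<le> norm p"
    by (intro psd_sandwich[OF cstar_positive_psd cstar_positive_psd algebra.psd_sa] pos)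
  also have "norm p \<le> (norm y)\<^sup>2 + (norm u)\<^sup>2"
    unfolding p_def by (rule order_trans[OF norm_triangle_ineq]) (simp add: norm_ip_self)
  also have "(norm u)\<^sup>2 \<le> (norm x * (t * norm c))\<^sup>2"
    unfolding u_def using norm_act_le[of x "t *\<^sub>R c"] t by (intro power_mono) simp_all
  also have "\<dots> = t * (norm c)\<^sup>2 * (t * (norm x)\<^sup>2)"
    by (simp add: power2_eq_square)
  finally have "2 * t * (norm c)\<^sup>2 \<le> (norm y)\<^sup>2 + t * (norm c)\<^sup>2"
    unfolding t(2) using t by (simp add: q cstar_identity)
  then have "t * (norm c)\<^sup>2 \<le> (norm y)\<^sup>2" by simp
  then have "(norm x)\<^sup>2 * (t * (norm c)\<^sup>2) \<le> (norm x)\<^sup>2 * (norm y)\<^sup>2" by (intro mult_left_mono) auto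
  then have "(norm c)\<^sup>2 \<le> (norm x * norm y)\<^sup>2"
    using t(2) by (simp add: power_mult_distrib mult.assoc[symmetric] mult.commute[of _ t])
  then show ?thesis unfolding c_def by (rule power2_le_imp_le) simp
qed

end

sublocale hilbert_cstar_module \<subseteq> cstar_form ip
  by (rule cstar_form.intro)
     (simp_all only: ip_add_right ip_scaleC_right ip_star norm_ip_self norm_ip_le)

section \<open>The closed graph theorem\<close>

text \<open>
  By Baire's theorem some ball around 0 lies in the closure of the vectors with \<open>norm (T u) \<le> 2 n\<close>.
  Hence each \<open>x\<close> can be approximated to any accuracy by some \<open>u\<close> with \<open>norm (T u) \<le> C * norm x\<close>.
  Approximating the successive remainders, halved each time, writes \<open>x\<close> as a series \<open>\<Sum>u k\<close> for which
  \<open>\<Sum>T (u k)\<close> converges absolutely; as the graph is closed, its sum is \<open>T x\<close>.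
\<close>

theorem closed_graph:
  fixes T :: "'a::banach \<Rightarrow> 'b::banach"
  assumes lin: "linear T"
    and closed: "\<And>X x y. X \<longlonglongrightarrow> x \<Longrightarrow> (\<lambda>n. T (X n)) \<longlonglongrightarrow> y \<Longrightarrow> T x = y"
  shows "bounded_linear T"
proof -
  interpret linear T by (rule lin)
  define A where "A n = closure {x. norm (T x) \<le> real n}" for n :: nat
  have closedA: "closed (A n)" for n by (simp add: A_def)
  have cover: "\<exists>n. x \<in> A n" for x
  proof -
    obtain n where "norm (T x) \<le> real n" using real_arch_simple by blast
    then have "x \<in> A n" unfolding A_def using closure_subset by fastforce
    then show ?thesis ..
  qed
  have "\<exists>n. interior (A n) \<noteq> {}"
  proof (rule ccontr)
    assume "\<not> ?thesis"
    then have int: "interior (A n) = {}" for n by simp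
    have "Met_TC.mcomplete TYPE('a)"
      by (simp add: mcomplete_iff_complete complete_UNIV)
    then have "Met_TC.mtopology interior_of \<Union>(range A) = {}"
      by (rule Met_TC.metric_Baire_category_alt) (auto simp: int closedA)
    moreover have "\<Union>(range A) = UNIV" using cover by auto
    ultimately show False by simp
  qed
  then obtain n x0 where "x0 \<in> interior (A n)" by blast
  then obtain r where r: "r > 0" "ball x0 r \<subseteq> A n" using mem_interior by blast
  define C where "C = 2 * (2 * real n) / r"
  have C: "C \<ge> 0" using r by (simp add: C_def)
  have small: "\<exists>u. norm (T u) \<le> 2 * real n \<and> norm (x - u) < e" if xr: "norm x < r" and e: "e > 0" for x e
  proof -
    have "x0 + x \<in> A n" "x0 \<in> A n" using r xr by (auto simp: subset_iff dist_norm)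
    then obtain a b where a: "norm (T a) \<le> real n" "dist a (x0 + x) < e / 2"
      and b: "norm (T b) \<le> real n" "dist b x0 < e / 2"
      using e unfolding A_def closure_approachable by (metis half_gt_zero mem_Collect_eq)
    have "norm (T (a - b)) \<le> 2 * real n"
      using a(1) b(1) norm_triangle_ineq4[of "T a" "T b"] by (simp add: diff)
    moreover have "x - (a - b) = (b - x0) - (a - (x0 + x))" by simp
    then have "norm (x - (a - b)) \<le> norm (b - x0) + norm (a - (x0 + x))"
      by (metis norm_triangle_ineq4)
    then have "norm (x - (a - b)) < e" using a(2) b(2) by (simp add: dist_norm)
    ultimately show ?thesis by blast
  qed
  have approx: "\<exists>u. norm (T u) \<le> C * norm x \<and> norm (x - u) < e" if e: "e > 0" for x e
  proof (cases "x = 0")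
    case True
    then show ?thesis using e by (intro exI[of _ 0]) (simp add: zero)
  next
    case False
    define k where "k = r / (2 * norm x)"
    have k: "k > 0" "norm (k *\<^sub>R x) < r" using False r by (simp_all add: k_def)
    obtain u where u: "norm (T u) \<le> 2 * real n" "norm (k *\<^sub>R x - u) < k * e"
      using small[OF k(2), of "k * e"] k(1) e by auto
    have "norm (T ((1 / k) *\<^sub>R u)) = (1 / k) * norm (T u)" using k by (simp add: scale)
    also have "\<dots> \<le> (1 / k) * (2 * real n)" using k u by (intro mult_left_mono) auto
    also have "\<dots> = C * norm x" using False r by (simp add: k_def C_def)
    finally have 1: "norm (T ((1 / k) *\<^sub>R u)) \<le> C * norm x" .
    have "k *\<^sub>R x - u = k *\<^sub>R (x - (1 / k) *\<^sub>R u)" using k by (simp add: scaleR_diff_right)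
    then have "k * norm (x - (1 / k) *\<^sub>R u) < k * e" using u(2) k by simp
    then have "norm (x - (1 / k) *\<^sub>R u) < e" using k by simp
    with 1 show ?thesis by blast
  qed
  define g where "g x e = (SOME u. norm (T u) \<le> C * norm x \<and> norm (x - u) < e)" for x e
  have g: "norm (T (g x e)) \<le> C * norm x" "norm (x - g x e) < e" if "e > 0" for x e
    unfolding g_def using someI_ex[OF approx[OF that, of x]] by blast+
  have "norm (T x) \<le> norm x * (2 * C)" for x
  proof (cases "x = 0")
    case True
    then show ?thesis by (simp add: zero)
  next
    case False
    \<comment> \<open>z k is the remainder before step k, and u k the approximation of it\<close>
    define z where "z = rec_nat x (\<lambda>k y. y - g y (norm x * (1/2) ^ Suc k))"
    define u where "u k = g (z k) (norm x * (1/2) ^ Suc k)" for k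
    have z0: "z 0 = x" and zS: "z (Suc k) = z k - u k" for k by (simp_all add: z_def u_def)
    have zn: "norm (z k) \<le> norm x * (1/2) ^ k" for k
    proof (cases k)
      case (Suc j)
      have "norm (z j - u j) < norm x * (1/2) ^ Suc j" unfolding u_def using False by (intro g) simp
      then show ?thesis using Suc zS by simp
    qed (simp add: z0)
    have un: "norm (T (u k)) \<le> C * norm x * (1/2) ^ k" for k
    proof -
      have "norm (T (u k)) \<le> C * norm (z k)" unfolding u_def using False by (intro g) simp
      also have "\<dots> \<le> C * (norm x * (1/2) ^ k)" by (intro mult_left_mono zn C)
      finally show ?thesis by simp
    qed
    have sumz: "(\<Sum>k<m. u k) = x - z m" for m
      by (induction m) (simp_all add: z0 zS)
    have geo: "(\<lambda>k. C * norm x * (1/2) ^ k) sums (C * norm x * 2)"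
      using geometric_sums[of "1/2::real"] by (intro sums_mult) simp
    have "(\<lambda>m. norm x * (1/2) ^ m) \<longlonglongrightarrow> norm x * 0" by (intro tendsto_mult tendsto_const LIMSEQ_power_zero) simp
    then have "(\<lambda>m. norm x * (1/2) ^ m) \<longlonglongrightarrow> 0" by simp
    then have "z \<longlonglongrightarrow> 0" by (rule Lim_null_comparison[rotated]) (simp add: zn)
    then have X: "(\<lambda>m. \<Sum>k<m. u k) \<longlonglongrightarrow> x"
      unfolding sumz using tendsto_diff[OF tendsto_const[of x]] by fastforce
    have sT: "summable (\<lambda>k. norm (T (u k)))"
      by (rule summable_comparison_test'[OF sums_summable[OF geo]]) (simp add: un)
    have "(\<lambda>m. \<Sum>k<m. T (u k)) \<longlonglongrightarrow> (\<Sum>k. T (u k))"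
      by (rule summable_LIMSEQ[OF summable_norm_cancel[OF sT]])
    then have "(\<lambda>m. T (\<Sum>k<m. u k)) \<longlonglongrightarrow> (\<Sum>k. T (u k))" by (simp add: sum)
    from closed[OF X this] have "norm (T x) \<le> (\<Sum>k. norm (T (u k)))"
      using summable_norm[OF sT] by simp
    also have "\<dots> \<le> (\<Sum>k. C * norm x * (1/2) ^ k)"
      by (rule suminf_le[OF un sT sums_summable[OF geo]])
    also have "\<dots> = C * norm x * 2" using geo by (simp add: sums_iff)
    finally show ?thesis by (simp add: mult_ac)
  qed
  then show ?thesis by (intro bounded_linear_intro[where K = "2 * C"]) (simp_all add: add scale)
qed


section \<open>Continuous functional calculus of a positive operator\<close>

definition cpoly :: "complex poly \<Rightarrow> 'e::complex_banach endo \<Rightarrow> 'e endo" where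
  "cpoly p T = (\<Sum>i\<le>degree p. scal (coeff p i) * T ^ i)"

definition rpoly :: "real poly \<Rightarrow> 'e::complex_banach endo \<Rightarrow> 'e endo" where
  "rpoly p T = (\<Sum>i\<le>degree p. coeff p i *\<^sub>R T ^ i)"

lemma cpoly_altdef: assumes "degree p \<le> n" shows "cpoly p T = (\<Sum>i\<le>n. scal (coeff p i) * T ^ i)"
  unfolding cpoly_def using assms by (intro sum.mono_neutral_left) (auto simp: coeff_eq_0)

lemma cpoly_0 [simp]: "cpoly 0 T = 0"
  by (simp add: cpoly_def)

lemma cpoly_pCons: "cpoly (pCons a p) T = scal a + T * cpoly p T"
proof -
  have "cpoly (pCons a p) T = (\<Sum>i\<le>Suc (degree p). scal (coeff (pCons a p) i) * T ^ i)"
    by (rule cpoly_altdef) (simp add: degree_pCons_le)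
  also have "\<dots> = scal a + (\<Sum>i\<le>degree p. scal (coeff p i) * (T * T ^ i))"
    by (subst sum.atMost_Suc_shift) simp
  also have "(\<Sum>i\<le>degree p. scal (coeff p i) * (T * T ^ i)) = T * cpoly p T"
    unfolding cpoly_def sum_distrib_left
    by (rule sum.cong) (metis mult.assoc scal_commute)+
  finally show ?thesis .
qed

lemma cpoly_add: "cpoly (p + q) T = cpoly p T + cpoly q T"
proof -
  let ?n = "max (degree p) (degree q)"
  have "cpoly (p + q) T = (\<Sum>i\<le>?n. scal (coeff (p + q) i) * T ^ i)"
    by (rule cpoly_altdef) (rule degree_add_le_max)
  also have "\<dots> = cpoly p T + cpoly q T"
    by (simp add: cpoly_altdef[of p ?n] cpoly_altdef[of q ?n] scal_add distrib_right sum.distrib)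
  finally show ?thesis .
qed

lemma cpoly_smult: "cpoly (smult c p) T = scal c * cpoly p T"
proof -
  have "cpoly (smult c p) T = (\<Sum>i\<le>degree p. scal (coeff (smult c p) i) * T ^ i)"
    by (rule cpoly_altdef) (rule degree_smult_le)
  then show ?thesis by (simp add: cpoly_def sum_distrib_left scal_mult mult.assoc)
qed

lemma cpoly_mult: "cpoly (p * q) T = cpoly p T * cpoly q T"
  by (induction p) (simp_all add: cpoly_pCons cpoly_add cpoly_smult distrib_right mult.assoc)

abbreviation complexify :: "real poly \<Rightarrow> complex poly" where
  "complexify \<equiv> map_poly complex_of_real"

lemma complexify_add: "complexify (p + q) = complexify p + complexify q"
  and complexify_mult: "complexify (p * q) = complexify p * complexify q"
  by (rule poly_eqI, simp add: coeff_map_poly coeff_mult)+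

lemma poly_complexify: "poly (complexify p) (complex_of_real x) = complex_of_real (poly p x)"
  by (induction p) (simp_all add: map_poly_pCons)

lemma rpoly_cpoly: "rpoly p T = cpoly (complexify p) T"
  by (simp add: rpoly_def cpoly_def coeff_map_poly degree_map_poly scal_of_real)

lemma rpoly_0 [simp]: "rpoly 0 T = 0"
  by (simp add: rpoly_def)

lemma rpoly_pCons: "rpoly (pCons a p) T = a *\<^sub>R 1 + T * rpoly p T"
  by (simp add: rpoly_cpoly map_poly_pCons cpoly_pCons scal_of_real)

lemma rpoly_add: "rpoly (p + q) T = rpoly p T + rpoly q T"
  and rpoly_mult: "rpoly (p * q) T = rpoly p T * rpoly q T"
  by (simp_all add: rpoly_cpoly complexify_add complexify_mult cpoly_add cpoly_mult)

lemma rpoly_diff: "rpoly (p - q) T = rpoly p T - rpoly q T"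
  using rpoly_add[of "p - q" q T] by simp

lemma rpoly_pcompose: "rpoly (pcompose p q) T = rpoly p (rpoly q T)"
  by (induction p) (simp_all add: pcompose_pCons rpoly_pCons rpoly_add rpoly_mult)

lemma app_rpoly: "app (rpoly p T) = op_poly p (app T)"
  by (rule ext) (simp add: rpoly_def op_poly_def app_sum app_power)

context cstar_form
begin

lemma sa_rpoly: "sa T \<Longrightarrow> sa (rpoly p T)"
  unfolding rpoly_def by (intro pair_sum pair_scaleR sa_power)

lemma inv_in_scal: "c \<noteq> 0 \<Longrightarrow> inv_in (scal c)"
  by (rule inv_inI[of "scal (1 / c)" "scal (1 / c)"]) (simp_all add: scal_mult[symmetric])

text \<open>
  The polynomial splits into linear factors, each of which is invertible at \<open>T\<close>.
\<close>

lemma inv_in_cpoly: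
  assumes T: "T \<in> Adj" and "p \<noteq> 0" and "\<And>z. z \<in> spec T \<Longrightarrow> poly p z \<noteq> 0"
  shows "inv_in (cpoly p T)"
  using assms(2,3)
proof (induction "degree p" arbitrary: p)
  case 0
  then obtain c where "p = [:c:]" by (metis degree_eq_zeroE)
  with 0 show ?case by (simp add: cpoly_pCons inv_in_scal)
next
  case (Suc n)
  then have "\<not> constant (poly p)" by (simp add: constant_degree)
  then obtain z where z: "poly p z = 0" using fundamental_theorem_of_algebra by blast
  then obtain q where q: "p = [:- z, 1:] * q" by (auto simp: poly_eq_0_iff_dvd)
  with Suc.prems have q0: "q \<noteq> 0" by auto
  have "degree p = Suc (degree q)" unfolding q by (subst degree_mult_eq) (use q0 in auto)
  then have "inv_in (cpoly q T)" using Suc q0 by (intro Suc.hyps) (auto simp: q)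
  moreover have "inv_in (scal z - T)" using z Suc.prems(2) by (auto simp: spec_def)
  then have "inv_in (T - scal z)" using inv_in_scaleR[of "scal z - T" "-1"] by simp
  then have "inv_in (cpoly [:- z, 1:] T)" by (simp add: cpoly_pCons scal_minus)
  ultimately show ?case unfolding q cpoly_mult by (intro inv_in_mult)
qed

text \<open>
  The spectral notion used in the statement. It implies \<open>psd\<close>; on a Hilbert module the converse
  comes from the inner product, in \<open>pos_if_form_nonneg\<close>.
\<close>

definition pos :: "'e endo \<Rightarrow> bool" where
  "pos T \<longleftrightarrow> sa T \<and> spec T \<subseteq> \<real>\<^sub>\<ge>\<^sub>0"

lemma pos_sa: "pos T \<Longrightarrow> sa T"
  by (simp add: pos_def)

lemma pos_psd: assumes "pos T" shows "psd T"
proof (rule psd_if_spec_nonneg)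
  fix r :: real assume "r < 0"
  then have "complex_of_real r \<notin> spec T" using assms by (auto simp: pos_def)
  then show "inv_in (r *\<^sub>R 1 - T)" by (simp add: spec_def scal_of_real)
qed (use assms pos_sa in auto)

lemma spec_real_bound: assumes "pos T" "complex_of_real r \<in> spec T" shows "r \<in> {0..norm T}"
proof -
  have "r \<ge> 0" using assms by (auto simp: pos_def)
  moreover have "\<not> norm T < \<bar>r\<bar>"
    using inv_in_norm_less[of T r] assms pos_sa AdjI by (auto simp: spec_def scal_of_real)
  ultimately show ?thesis by simp
qed

lemma spec_nonempty: assumes "sa T" "(1::'e endo) \<noteq> 0" shows "\<exists>z. z \<in> spec T"
proof (cases "T = 0")
  case True
  then have "0 \<in> spec T" using assms(2) by (auto simp: spec_def inv_in_def)
  then show ?thesis ..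
next
  case False
  from norm_in_spec[OF assms(1) this]
  have "complex_of_real (norm T) \<in> spec T \<or> complex_of_real (- norm T) \<in> spec T"
    unfolding spec_def mem_Collect_eq scal_of_real .
  then show ?thesis by blast
qed

text \<open>
  The operator \<open>p(T)\<close> is self-adjoint, so its norm is, up to sign, a spectral value \<open>\<mu>\<close> of \<open>p(T)\<close>. By
  \<open>inv_in_cpoly\<close> the polynomial \<open>\<mu> - p\<close> vanishes somewhere on the spectrum of \<open>T\<close>.
\<close>

lemma norm_rpoly_le:
  assumes T: "pos T" and M: "M \<ge> 0" "\<And>r. complex_of_real r \<in> spec T \<Longrightarrow> \<bar>poly p r\<bar> \<le> M"
  shows "norm (rpoly p T) \<le> M"
proof (cases "rpoly p T = 0")
  case False
  from norm_in_spec[OF sa_rpoly[OF pos_sa[OF T]] this]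
  obtain \<mu> where \<mu>: "\<bar>\<mu>\<bar> = norm (rpoly p T)" "\<not> inv_in (\<mu> *\<^sub>R 1 - rpoly p T)"
    by (metis abs_minus_cancel abs_norm_cancel)
  have "\<mu> *\<^sub>R 1 - rpoly p T = cpoly (complexify ([:\<mu>:] - p)) T"
    by (simp add: rpoly_cpoly[symmetric] rpoly_diff rpoly_pCons)
  with \<mu>(2) have ninv: "\<not> inv_in (cpoly (complexify ([:\<mu>:] - p)) T)" by simp
  have one: "(1::'e endo) \<noteq> 0" using False by (metis mult_1_left mult_zero_left)
  have "\<exists>z\<in>spec T. poly (complexify ([:\<mu>:] - p)) z = 0"
  proof (cases "complexify ([:\<mu>:] - p) = 0")
    case True
    \<comment> \<open>p is the constant mu, and any spectral value will do\<close>
    then show ?thesis using spec_nonempty[OF pos_sa[OF T] one] by auto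
  next
    case False
    then show ?thesis using inv_in_cpoly[OF AdjI[OF pos_sa[OF T]] False] ninv by blast
  qed
  then obtain z where z: "z \<in> spec T" "poly (complexify ([:\<mu>:] - p)) z = 0" by blast
  then have "z \<in> \<real>\<^sub>\<ge>\<^sub>0" using T by (auto simp: pos_def)
  then obtain r where r: "z = complex_of_real r" by (auto elim: nonneg_Reals_cases)
  with z(2) have "\<mu> = poly p r" by (simp add: poly_complexify)
  with M(2)[of r] z(1) \<mu>(1) r show ?thesis by simp
qed (use M in simp)

text \<open>
  For positive \<open>T\<close>, the relation whose unique solution \<open>op_cfc\<close> selects; a candidate \<open>S\<close> is
  verified by exhibiting polynomials.
\<close>

definition is_cfc :: "(real \<Rightarrow> real) \<Rightarrow> 'e endo \<Rightarrow> 'e endo \<Rightarrow> bool" where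
  "is_cfc f T S \<longleftrightarrow> (\<exists>p. uniform_limit {r. complex_of_real r \<in> spec T} (\<lambda>n. poly (p n)) f sequentially
      \<and> (\<lambda>n. rpoly (p n) T) \<longlonglongrightarrow> S)"

lemma is_cfc_sa: "pos T \<Longrightarrow> is_cfc f T S \<Longrightarrow> sa S"
  using sa_limit sa_rpoly pos_sa unfolding is_cfc_def by metis

lemma is_cfc_unique: assumes T: "pos T" and S: "is_cfc f T S" "is_cfc f T S'" shows "S = S'"
proof -
  let ?X = "{r. complex_of_real r \<in> spec T}"
  from S obtain p q where p: "uniform_limit ?X (\<lambda>n. poly (p n)) f sequentially" "(\<lambda>n. rpoly (p n) T) \<longlonglongrightarrow> S"
    and q: "uniform_limit ?X (\<lambda>n. poly (q n)) f sequentially" "(\<lambda>n. rpoly (q n) T) \<longlonglongrightarrow> S'"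
    by (auto simp: is_cfc_def)
  have "uniform_limit ?X (\<lambda>n r. poly (p n) r - poly (q n) r) (\<lambda>r. f r - f r) sequentially"
    by (intro uniform_limit_intros p q)
  moreover have "poly (p n - q n) = (\<lambda>r. poly (p n) r - poly (q n) r)" for n by (rule ext) simp
  ultimately have u: "uniform_limit ?X (\<lambda>n. poly (p n - q n)) (\<lambda>r. 0) sequentially" by simp
  have "(\<lambda>n. rpoly (p n - q n) T) \<longlonglongrightarrow> 0"
  proof (rule tendstoI)
    fix e :: real assume e: "e > 0"
    show "\<forall>\<^sub>F n in sequentially. dist (rpoly (p n - q n) T) 0 < e"
    proof (rule eventually_mono[OF uniform_limitD[OF u, of "e / 2"]])
      fix n assume "\<forall>x\<in>?X. dist (poly (p n - q n) x) 0 < e / 2"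
      then have "norm (rpoly (p n - q n) T) \<le> e / 2"
        using e by (intro norm_rpoly_le[OF T]) auto
      then show "dist (rpoly (p n - q n) T) 0 < e" using e by simp
    qed (use e in simp)
  qed
  moreover have "(\<lambda>n. rpoly (p n - q n) T) \<longlonglongrightarrow> S - S'"
    unfolding rpoly_diff by (intro tendsto_diff p q)
  ultimately show ?thesis using LIMSEQ_unique by fastforce
qed

lemma polynomial_approximation:
  assumes "continuous_on {0..b} (f :: real \<Rightarrow> real)"
  obtains p where "uniform_limit {0..b} (\<lambda>n. poly (p n)) f sequentially"
proof -
  have "\<exists>p. \<forall>x\<in>{0..b}. \<bar>f x - poly p x\<bar> < 1 / real (Suc n)" for n
  proof -
    obtain g where g: "real_polynomial_function g" "\<And>x. x \<in> {0..b} \<Longrightarrow> \<bar>f x - g x\<bar> < 1 / real (Suc n)"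
      using Stone_Weierstrass_real_polynomial_function[OF compact_Icc assms, of "1 / real (Suc n)"] by auto
    then obtain a m where "g = (\<lambda>x. \<Sum>i\<le>m. a i * x ^ i)"
      using real_polynomial_function_iff_sum by auto
    then have "g x = poly (\<Sum>i\<le>m. monom (a i) i) x" for x
      by (simp add: poly_sum poly_monom)
    with g(2) show ?thesis by metis
  qed
  then obtain p where p: "\<And>n x. x \<in> {0..b} \<Longrightarrow> \<bar>f x - poly (p n) x\<bar> < 1 / real (Suc n)" by metis
  have "uniform_limit {0..b} (\<lambda>n. poly (p n)) f sequentially"
  proof (rule uniform_limitI)
    fix e :: real assume "e > 0"
    then obtain N where N: "1 / real (Suc N) < e" using nat_approx_posE by blast
    show "\<forall>\<^sub>F n in sequentially. \<forall>x\<in>{0..b}. dist (poly (p n) x) (f x) < e"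
    proof (rule eventually_sequentiallyI, intro ballI)
      fix n x assume "N \<le> n" "x \<in> {0..b}"
      then have "\<bar>f x - poly (p n) x\<bar> < 1 / real (Suc n)" "1 / real (Suc n) \<le> 1 / real (Suc N)"
        using p by (auto simp: field_simps)
      with N show "dist (poly (p n) x) (f x) < e" by (simp add: dist_real_def abs_minus_commute)
    qed
  qed
  then show ?thesis by (rule that)
qed

text \<open>
  Polynomials that approximate \<open>f\<close> on \<open>[0, norm T]\<close>, an interval containing the spectrum, have Cauchy
  values at \<open>T\<close> by \<open>norm_rpoly_le\<close>.
\<close>

lemma is_cfc_exists:
  assumes T: "pos T" and f: "continuous_on {0..norm T} f"
  shows "\<exists>S. is_cfc f T S"
proof -
  obtain p where p: "uniform_limit {0..norm T} (\<lambda>n. poly (p n)) f sequentially"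
    using polynomial_approximation[OF f] by blast
  have sub: "{r. complex_of_real r \<in> spec T} \<subseteq> {0..norm T}" using spec_real_bound[OF T] by blast
  have "uniformly_Cauchy_on {0..norm T} (\<lambda>n. poly (p n))"
    by (rule uniformly_convergent_Cauchy) (use p in \<open>auto simp: uniformly_convergent_on_def\<close>)
  have "Cauchy (\<lambda>n. rpoly (p n) T)"
  proof (rule CauchyI)
    fix e :: real assume e: "e > 0"
    then obtain N where N: "\<And>m n x. m \<ge> N \<Longrightarrow> n \<ge> N \<Longrightarrow> x \<in> {0..norm T} \<Longrightarrow> dist (poly (p m) x) (poly (p n) x) < e / 2"
      using \<open>uniformly_Cauchy_on _ _\<close> unfolding uniformly_Cauchy_on_def
      by (metis half_gt_zero)
    have "norm (rpoly (p m) T - rpoly (p n) T) < e" if "m \<ge> N" "n \<ge> N" for m n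
    proof -
      have "norm (rpoly (p m - p n) T) \<le> e / 2"
      proof (rule norm_rpoly_le[OF T])
        fix r assume "complex_of_real r \<in> spec T"
        then show "\<bar>poly (p m - p n) r\<bar> \<le> e / 2"
          using N[OF that, of r] sub by (auto simp: dist_real_def)
      qed (use e in simp)
      then show ?thesis using e by (simp add: rpoly_diff)
    qed
    then show "\<exists>M. \<forall>m\<ge>M. \<forall>n\<ge>M. norm (rpoly (p m) T - rpoly (p n) T) < e" by blast
  qed
  then obtain S where "(\<lambda>n. rpoly (p n) T) \<longlonglongrightarrow> S"
    using Cauchy_convergent_iff convergent_def by blast
  then show ?thesis
    unfolding is_cfc_def using uniform_limit_on_subset[OF p sub] by blast
qed

lemma is_cfc_mult:
  assumes T: "pos T" and f: "continuous_on {0..norm T} f" "is_cfc f T S"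
    and g: "continuous_on {0..norm T} g" "is_cfc g T S'"
  shows "is_cfc (\<lambda>x. f x * g x) T (S * S')"
proof -
  let ?X = "{r. complex_of_real r \<in> spec T}"
  have sub: "?X \<subseteq> {0..norm T}" using spec_real_bound[OF T] by blast
  have bdd: "bounded (h ` ?X)" if "continuous_on {0..norm T} h" for h :: "real \<Rightarrow> real"
    using compact_imp_bounded[OF compact_continuous_image[OF that compact_Icc]] sub
    by (meson bounded_subset image_mono)
  from f(2) g(2) obtain p q where
    p: "uniform_limit ?X (\<lambda>n. poly (p n)) f sequentially" "(\<lambda>n. rpoly (p n) T) \<longlonglongrightarrow> S" and
    q: "uniform_limit ?X (\<lambda>n. poly (q n)) g sequentially" "(\<lambda>n. rpoly (q n) T) \<longlonglongrightarrow> S'"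
    by (auto simp: is_cfc_def)
  have "uniform_limit ?X (\<lambda>n r. poly (p n) r * poly (q n) r) (\<lambda>x. f x * g x) sequentially"
    by (rule uniform_lim_mult[OF p(1) q(1) bdd[OF f(1)] bdd[OF g(1)]])
  moreover have "poly (p n * q n) = (\<lambda>r. poly (p n) r * poly (q n) r)" for n by (rule ext) simp
  ultimately have "uniform_limit ?X (\<lambda>n. poly (p n * q n)) (\<lambda>x. f x * g x) sequentially"
    by simp
  moreover have "(\<lambda>n. rpoly (p n * q n) T) \<longlonglongrightarrow> S * S'"
    unfolding rpoly_mult by (intro tendsto_mult p q)
  ultimately show ?thesis unfolding is_cfc_def by (intro exI[of _ "\<lambda>n. p n * q n"] conjI)
qed

lemma is_cfc_cong:
  assumes T: "pos T" and f: "is_cfc f T S" and eq: "\<And>x. x \<ge> 0 \<Longrightarrow> f x = g x"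
  shows "is_cfc g T S"
proof -
  have "uniform_limit {r. complex_of_real r \<in> spec T} (\<lambda>n. poly (p n)) f sequentially \<longleftrightarrow>
    uniform_limit {r. complex_of_real r \<in> spec T} (\<lambda>n. poly (p n)) g sequentially" for p
    using spec_real_bound[OF T] by (intro uniform_limit_cong') (auto intro: eq)
  with f show ?thesis by (simp add: is_cfc_def)
qed

lemma is_cfc_id: "is_cfc (\<lambda>x. x) T T"
  unfolding is_cfc_def
  by (intro exI[of _ "\<lambda>n. [:0, 1:]"] conjI) (auto simp: uniform_limit_iff rpoly_pCons)

text \<open>
  This is uniqueness of the positive square root. If \<open>p\<^sub>n\<close> tends to the square root on an interval
  containing the spectrum of \<open>P\<^sup>2\<close> and the squares of that of \<open>P\<close>, then \<open>p\<^sub>n(t\<^sup>2)\<close> tends to \<open>t\<close> uniformly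
  on the spectrum of \<open>P\<close>, and \<open>p\<^sub>n(P\<^sup>2)\<close> is the value of this polynomial at \<open>P\<close>.
\<close>

lemma is_cfc_sqrt_square:
  assumes P: "pos P" and PP: "pos (P * P)"
  shows "is_cfc sqrt (P * P) P"
proof -
  define b where "b = max (norm (P * P)) ((norm P)\<^sup>2)"
  obtain p where p: "uniform_limit {0..b} (\<lambda>n. poly (p n)) sqrt sequentially"
    using polynomial_approximation[OF continuous_on_real_sqrt[OF continuous_on_id]] by blast
  have "uniform_limit {r. complex_of_real r \<in> spec (P * P)} (\<lambda>n. poly (p n)) sqrt sequentially"
    by (rule uniform_limit_on_subset[OF p]) (use spec_real_bound[OF PP] in \<open>force simp: b_def\<close>)
  moreover have "(\<lambda>n. rpoly (p n) (P * P)) \<longlonglongrightarrow> P"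
  proof (rule tendstoI)
    fix e :: real assume e: "e > 0"
    have conv: "rpoly (p n) (P * P) - P = rpoly (pcompose (p n) [:0, 0, 1:] - [:0, 1:]) P" for n
      by (simp add: rpoly_diff rpoly_pcompose rpoly_pCons)
    show "\<forall>\<^sub>F n in sequentially. dist (rpoly (p n) (P * P)) P < e"
    proof (rule eventually_mono[OF uniform_limitD[OF p, of "e / 2"]])
      fix n assume n: "\<forall>x\<in>{0..b}. dist (poly (p n) x) (sqrt x) < e / 2"
      have "norm (rpoly (p n) (P * P) - P) \<le> e / 2"
        unfolding conv
      proof (rule norm_rpoly_le[OF P])
        fix r assume "complex_of_real r \<in> spec P"
        then have r: "0 \<le> r" "r \<le> norm P" using spec_real_bound[OF P] by auto
        then have "r\<^sup>2 \<le> (norm P)\<^sup>2" by (intro power_mono)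
        then have "r\<^sup>2 \<in> {0..b}" by (simp add: b_def le_max_iff_disj)
        with n have "dist (poly (p n) (r\<^sup>2)) (sqrt (r\<^sup>2)) < e / 2" by blast
        then show "\<bar>poly (pcompose (p n) [:0, 0, 1:] - [:0, 1:]) r\<bar> \<le> e / 2"
          using r by (simp add: poly_pcompose dist_real_def power2_eq_square)
      qed (use e in simp)
      then show "dist (rpoly (p n) (P * P)) P < e" using e by (simp add: dist_norm)
    qed (use e in simp)
  qed
  ultimately show ?thesis by (auto simp: is_cfc_def)
qed

end


section \<open>From functions to elements of the operator algebra\<close>

context cstar_form
begin

lemma form_eqI_left: "(\<And>z. ip x z = ip y z) \<Longrightarrow> x = y"
  by (rule form_eqI) (metis form_star)

text \<open>
  Linearity is read off from the adjoint by definiteness of the form; boundedness follows from the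
  closed graph theorem, since \<open>ip (T x) z = ip x (S z)\<close> is continuous in \<open>x\<close>.
\<close>

lemma adjointable_imp_endo:
  assumes "adjointable ip T" obtains t where "T = app t"
proof -
  from assms obtain S where S: "\<And>x y. ip (T x) y = ip x (S y)" by (auto simp: adjointable_def)
  have add: "T (x + y) = T x + T y" for x y
    by (rule form_eqI_left) (simp add: form_add_left S)
  have scale: "T (c *\<^sub>C x) = c *\<^sub>C T x" for c x
    by (rule form_eqI_left) (simp add: form_scaleC_left S)
  have "bounded_linear T"
  proof (rule closed_graph)
    show "linear T" by (rule linearI) (simp_all add: add scaleR_scaleC scale)
    fix X x y assume X: "X \<longlonglongrightarrow> x" and TX: "(\<lambda>n. T (X n)) \<longlonglongrightarrow> y"
    show "T x = y"
    proof (rule form_eqI_left)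
      fix z
      have "(\<lambda>n. ip (T (X n)) z) \<longlonglongrightarrow> ip (T x) z"
        unfolding S by (rule tendsto_form_left[OF X])
      then show "ip (T x) z = ip y z" using tendsto_form_left[OF TX] LIMSEQ_unique by blast
    qed
  qed
  then have "T = app (Endo T)" using scale by (simp add: Endo_inverse)
  then show ?thesis by (rule that)
qed

lemma adjointable_app: "adjointable ip (app t) \<longleftrightarrow> t \<in> Adj"
proof
  assume "adjointable ip (app t)"
  then obtain S where S: "\<And>x y. ip (app t x) y = ip x (S y)" by (auto simp: adjointable_def)
  then have "ip (S x) y = ip x (app t y)" for x y by (metis form_star)
  then have "adjointable ip S" by (auto simp: adjointable_def)
  then obtain s where "S = app s" by (rule adjointable_imp_endo)
  with S show "t \<in> Adj" by (auto simp: Adj_def adjoint_pair_def)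
qed (auto simp: Adj_def adjoint_pair_def adjointable_def)

lemma adjointable_Adj:
  assumes "adjointable ip T" obtains t where "t \<in> Adj" "T = app t"
  using adjointable_imp_endo[OF assms] assms adjointable_app by metis

lemma adj_app: assumes "t \<in> Adj" shows "adj ip (app t) = app (ad t)"
  unfolding adj_def
proof (rule the_equality)
  show p: "\<forall>x y. ip (app t x) y = ip x (app (ad t) y)"
    using ad_pair[OF assms] by (simp add: adjoint_pair_def)
  fix S assume "\<forall>x y. ip (app t x) y = ip x (S y)"
  then show "S = app (ad t)" using p by (intro ext form_eqI) metis
qed

lemma app_comp: "app (s * t) = app s \<circ> app t"
  by (rule ext) simp

lemma app_id: "app 1 = id"
  by (rule ext) simp

lemma op_spectrum_app: "op_spectrum ip (app t) = spec t"
proof -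
  have shift: "(\<lambda>x. z *\<^sub>C x - app t x) = app (scal z - t)" for z by (rule ext) simp
  have "(\<exists>S. adjointable ip S \<and> S \<circ> app u = id \<and> app u \<circ> S = id) \<longleftrightarrow> inv_in u" for u
  proof
    assume "\<exists>S. adjointable ip S \<and> S \<circ> app u = id \<and> app u \<circ> S = id"
    then obtain s where "s \<in> Adj" "app s \<circ> app u = id" "app u \<circ> app s = id"
      using adjointable_Adj by metis
    then show "inv_in u"
      unfolding inv_in_def app_comp[symmetric] app_id[symmetric] app_inject by blast
  next
    assume "inv_in u"
    then obtain s where "s \<in> Adj" "s * u = 1" "u * s = 1" by (auto simp: inv_in_def)
    then have "adjointable ip (app s)" "app s \<circ> app u = id" "app u \<circ> app s = id"
      by (simp_all add: adjointable_app app_comp[symmetric] app_id)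
    then show "\<exists>S. adjointable ip S \<and> S \<circ> app u = id \<and> app u \<circ> S = id" by blast
  qed
  then show ?thesis unfolding op_spectrum_def spec_def shift by simp
qed

lemma op_positive_app: "op_positive ip (app t) \<longleftrightarrow> pos t"
proof
  assume "op_positive ip (app t)"
  then have "t \<in> Adj" "ad t = t" "spec t \<subseteq> \<real>\<^sub>\<ge>\<^sub>0"
    by (auto simp: op_positive_def adjointable_app op_spectrum_app adj_app app_inject)
  then show "pos t" using ad_pair by (force simp: pos_def)
next
  assume "pos t"
  then show "op_positive ip (app t)"
    using AdjI[of t t] ad_eqI[of t t]
    by (simp add: op_positive_def adjointable_app op_spectrum_app adj_app pos_def)
qed

lemma op_positive_endo: assumes "op_positive ip T" obtains t where "pos t" "T = app t"
  using assms adjointable_imp_endo[of T] op_positive_app by (metis op_positive_def)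

lemma op_cfc_app: assumes T: "pos T" and S: "is_cfc f T S" shows "op_cfc ip f (app T) = app S"
  unfolding op_cfc_def
proof (rule the_equality)
  have nrm: "onorm (\<lambda>x. op_poly p (app T) x - app s x) = norm (rpoly p T - s)" for p s
  proof -
    have "(\<lambda>x. op_poly p (app T) x - app s x) = app (rpoly p T - s)"
      by (rule ext) (simp add: app_rpoly)
    then show ?thesis by (simp add: norm_endo.rep_eq)
  qed
  have lim: "(\<lambda>n. onorm (\<lambda>x. op_poly (p n) (app T) x - app s x)) \<longlonglongrightarrow> 0 \<longleftrightarrow>
    (\<lambda>n. rpoly (p n) T) \<longlonglongrightarrow> s" for p s
    unfolding nrm tendsto_norm_zero_iff LIM_zero_iff ..
  show "adjointable ip (app S) \<and> (\<exists>p. uniform_limit {r. complex_of_real r \<in> op_spectrum ip (app T)}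
      (\<lambda>n. poly (p n)) f sequentially \<and> (\<lambda>n. onorm (\<lambda>x. op_poly (p n) (app T) x - app S x)) \<longlonglongrightarrow> 0)"
    using S AdjI[OF is_cfc_sa[OF T S]] unfolding lim op_spectrum_app is_cfc_def adjointable_app by blast
  fix S' assume S': "adjointable ip S' \<and> (\<exists>p. uniform_limit {r. complex_of_real r \<in> op_spectrum ip (app T)}
      (\<lambda>n. poly (p n)) f sequentially \<and> (\<lambda>n. onorm (\<lambda>x. op_poly (p n) (app T) x - S' x)) \<longlonglongrightarrow> 0)"
  then obtain s where s: "S' = app s" using adjointable_imp_endo by blast
  from S' have "is_cfc f T s" unfolding s lim op_spectrum_app is_cfc_def by blast
  then show "S' = app S" using is_cfc_unique[OF T S] s by simp
qed

lemma continuous_on_powr_nonneg: "0 < \<alpha> \<Longrightarrow> continuous_on {0..b} (\<lambda>t::real. t powr \<alpha>)"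
  by (intro continuous_on_powr' continuous_on_id continuous_on_const) auto

lemma is_cfc_powr_exists:
  assumes "pos T" "0 < \<alpha>"
  obtains S where "is_cfc (\<lambda>t. t powr \<alpha>) T S" "sa S" "op_powr ip (app T) \<alpha> = app S"
  using is_cfc_exists[OF assms(1) continuous_on_powr_nonneg[OF assms(2)]]
    is_cfc_sa[OF assms(1)] op_cfc_app[OF assms(1)] unfolding op_powr_def by metis

lemma is_cfc_powr_mult:
  assumes T: "pos T" and \<alpha>: "0 < \<alpha>" "0 < \<beta>"
    and S: "is_cfc (\<lambda>t. t powr \<alpha>) T S" "is_cfc (\<lambda>t. t powr \<beta>) T S'"
  shows "is_cfc (\<lambda>t. t powr (\<alpha> + \<beta>)) T (S * S')"
  unfolding powr_add
  by (intro is_cfc_mult[OF T] continuous_on_powr_nonneg \<alpha> S)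

lemma is_cfc_powr_one: "pos T \<Longrightarrow> is_cfc (\<lambda>t. t powr 1) T T"
  by (rule is_cfc_cong[OF _ is_cfc_id]) simp_all

lemma op_powr_half_square:
  assumes P: "pos P" and PP: "pos (P * P)"
  shows "op_powr ip (app (P * P)) (1/2) = app P"
  unfolding op_powr_def
  by (rule op_cfc_app[OF PP is_cfc_cong[OF PP is_cfc_sqrt_square[OF P PP]]]) (simp add: powr_half_sqrt)

end

section \<open>Positive operators on a Hilbert module\<close>

context hilbert_cstar_module
begin

lemma norm_ip_self_mono: "norm (ip u u) \<le> norm (ip u u + ip v v)"
  by (intro cstar_positive_norm_mono ip_positive)

text \<open>
  For \<open>r < 0\<close> and \<open>B = Y - r\<close>, the value \<open>ip y (B y)\<close> is the sum of \<open>ip u u\<close> and \<open>-r\<close> times \<open>ip y y\<close>, so by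
  Cauchy-Schwarz \<open>B\<close> is bounded below by \<open>-r\<close> on the dense set, hence everywhere, and
  \<open>sa_bounded_below_inv\<close> applies.
\<close>

lemma pos_if_form_nonneg:
  assumes Y: "sa Y" and dense: "closure D = UNIV"
    and form: "\<And>y. y \<in> D \<Longrightarrow> \<exists>u. ip y (app Y y) = ip u u"
  shows "pos Y"
proof -
  have neg: "inv_in (scal (complex_of_real r) - Y)" if r: "r < 0" for r
  proof -
    define B where "B = Y - r *\<^sub>R 1"
    have B: "sa B" unfolding B_def by (intro pair_diff pair_scaleR pair_1 Y)
    have "- r * norm y \<le> norm (app B y)" if y: "y \<in> D" for y
    proof (cases "y = 0")
      case False
      from form[OF y] obtain u where u: "ip y (app Y y) = ip u u" by blast
      let ?v = "sqrt (- r) *\<^sub>R y"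
      have v: "ip ?v ?v = - r *\<^sub>R ip y y" using r by simp
      have "- r * (norm y)\<^sup>2 = norm (ip ?v ?v)" unfolding v using r by (simp add: norm_form_self)
      also have "\<dots> \<le> norm (ip ?v ?v + ip u u)" by (rule norm_ip_self_mono)
      also have "ip ?v ?v + ip u u = ip y (app B y)"
        unfolding v by (simp add: B_def form_diff_right u)
      also have "norm \<dots> \<le> norm y * norm (app B y)" by (rule cauchy_schwarz)
      finally have "norm y * (- r * norm y) \<le> norm y * norm (app B y)"
        by (simp add: power2_eq_square mult.left_commute)
      then show ?thesis using False by (metis mult_le_cancel_left_pos zero_less_norm_iff)
    qed simp
    then have "D \<subseteq> {y. - r * norm y \<le> norm (app B y)}" by blast
    moreover have "closed {y. - r * norm y \<le> norm (app B y)}"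
      by (intro closed_Collect_le continuous_intros
          bounded_linear.continuous_on[OF app_bounded_linear])
    ultimately have "closure D \<subseteq> {y. - r * norm y \<le> norm (app B y)}" by (rule closure_minimal)
    then have "- r * norm y \<le> norm (app B y)" for y using dense by blast
    then have "inv_in B" using r by (intro sa_bounded_below_inv[OF B, of "- r"]) auto
    then have "inv_in ((-1) *\<^sub>R B)" by (rule inv_in_scaleR) simp
    then show ?thesis by (simp add: B_def scal_of_real)
  qed
  have "z \<in> \<real>\<^sub>\<ge>\<^sub>0" if "z \<in> spec Y" for z
  proof -
    have im: "Im z = 0" using sa_nonreal_inv[OF Y, of z] that by (auto simp: spec_def)
    then have z: "z = complex_of_real (Re z)" by (simp add: complex_eq_iff)
    then have "\<not> Re z < 0" using neg[of "Re z"] that by (auto simp: spec_def)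
    with im show ?thesis by (simp add: complex_nonneg_Reals_iff)
  qed
  then show ?thesis using Y by (auto simp: pos_def)
qed

lemma pos_factor: assumes "adjoint_pair A B" shows "pos (B * A)"
proof (rule pos_if_form_nonneg[of _ UNIV])
  show "sa (B * A)" using pair_mult[OF adjoint_pair_sym[OF assms] assms] .
  show "\<exists>u. ip y (app (B * A) y) = ip u u" for y
    using assms by (intro exI[of _ "app A y"]) (simp add: adjoint_pair_def)
qed simp

lemma pos_square: "sa S \<Longrightarrow> pos (S * S)"
  by (rule pos_factor)

lemma pos_sqrt: assumes "pos T" obtains S where "sa S" "S * S = T"
  using psd_sqrt[OF pos_psd[OF assms]] by metis

lemma pos_conj: assumes "pos T" "adjoint_pair A B" shows "pos (B * T * A)"
proof -
  obtain S where S: "sa S" "S * S = T" using pos_sqrt[OF assms(1)] by blast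
  have "pos ((B * S) * (S * A))" by (rule pos_factor[OF pair_mult[OF S(1) assms(2)]])
  then show ?thesis using S(2) by (metis mult.assoc)
qed

text \<open>
  Such a difference is a square, and the inner product turns squares into positive operators.
\<close>

lemma pos_norm_minus: assumes "sa T" "norm T \<le> s" shows "pos (s *\<^sub>R 1 - T)"
  using psd_sqrt[OF psd_norm_minus[OF assms]] pos_square by metis

end


section \<open>Range inclusion and factorization\<close>

lemma Cauchy_dominated:
  fixes X :: "nat \<Rightarrow> 'b::real_normed_vector" and Y :: "nat \<Rightarrow> 'c::real_normed_vector"
  assumes X: "Cauchy X" and dom: "\<And>m n. norm (Y m - Y n) \<le> b * norm (X m - X n)"
  shows "Cauchy Y"
proof (rule CauchyI)
  fix e :: real assume e: "e > 0"
  have b: "\<bar>b\<bar> + 1 > 0" by (simp add: add_nonneg_pos)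
  with e have "e / (\<bar>b\<bar> + 1) > 0" by simp
  then obtain M where M: "\<And>m n. m \<ge> M \<Longrightarrow> n \<ge> M \<Longrightarrow> norm (X m - X n) < e / (\<bar>b\<bar> + 1)"
    using X unfolding Cauchy_iff by blast
  have "norm (Y m - Y n) < e" if "m \<ge> M" "n \<ge> M" for m n
  proof -
    have "norm (Y m - Y n) \<le> \<bar>b\<bar> * norm (X m - X n)"
      by (rule order_trans[OF dom mult_right_mono]) simp_all
    also have "\<dots> \<le> \<bar>b\<bar> * (e / (\<bar>b\<bar> + 1))" using M[OF that] by (intro mult_left_mono) auto
    also have "\<dots> < e" using e b by (simp add: pos_divide_less_eq)
    finally show ?thesis .
  qed
  then show "\<exists>M. \<forall>m\<ge>M. \<forall>n\<ge>M. norm (Y m - Y n) < e" by blast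
qed

lemma closure_range_sequence:
  fixes f :: "'b \<Rightarrow> 'a::first_countable_topology"
  assumes "y \<in> closure (range f)"
  obtains z where "(\<lambda>n. f (z n)) \<longlonglongrightarrow> y"
proof -
  from assms obtain X where X: "\<And>n. X n \<in> range f" "X \<longlonglongrightarrow> y"
    unfolding closure_sequential by blast
  from X(1) have "\<forall>n. \<exists>z. X n = f z" by blast
  then obtain z where "\<forall>n. X n = f (z n)" using choice[of "\<lambda>n z. X n = f z"] by blast
  then have "X = (\<lambda>n. f (z n))" by (intro ext) simp
  with X(2) have "(\<lambda>n. f (z n)) \<longlonglongrightarrow> y" by simp
  then show ?thesis by (rule that)
qed

context hilbert_cstar_module
begin

lemma sa_dense_range_inj:
  assumes r: "sa r" and dense: "closure (range (app r)) = UNIV" and eq: "app r x = app r y"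
  shows "x = y"
proof -
  have "range (app r) \<subseteq> {z. ip (x - y) z = 0}"
    using r eq by (auto simp: adjoint_pair_def[THEN iffD1, rule_format, symmetric] app_diff)
  moreover have "closed {z. ip (x - y) z = 0}"
    by (intro closed_Collect_eq continuous_on_const
        bounded_linear.continuous_on[OF bounded_linear_form_right] continuous_on_id)
  ultimately have "closure (range (app r)) \<subseteq> {z. ip (x - y) z = 0}" by (rule closure_minimal)
  then have "ip (x - y) (x - y) = 0" using dense by blast
  then show ?thesis using form_definite by fastforce
qed

lemma endo_eq_on_dense:
  assumes dense: "closure (range (app r)) = UNIV" and eq: "a * r = b * r"
  shows "a = b"
proof (rule endo_eqI)
  fix y
  obtain z where z: "(\<lambda>n. app r (z n)) \<longlonglongrightarrow> y"
    using dense closure_range_sequence[of y "app r"] by blast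
  have "app a (app r x) = app b (app r x)" for x
    using eq by (metis app_times)
  then have "(\<lambda>n. app a (app r (z n))) \<longlonglongrightarrow> app b y"
    using tendsto_app_right[OF z, of b] by simp
  then show "app a y = app b y"
    using tendsto_app_right[OF z, of a] LIMSEQ_unique by blast
qed

lemma sandwich_cancel:
  assumes r: "sa r" and dense: "closure (range (app r)) = UNIV" and eq: "r * a * r = r * b * r"
  shows "a = b"
proof -
  have "r * a = r * b" using eq by (rule endo_eq_on_dense[OF dense])
  then have "app r (app a x) = app r (app b x)" for x by (metis app_times)
  then show ?thesis using sa_dense_range_inj[OF r dense] by (intro endo_eqI) blast
qed

text \<open>
  The quotient \<open>d\<close> with \<open>r d = c\<close> is bounded by the closed graph theorem. For its adjoint, \<open>d\<^sup>*\<close> has to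
  send \<open>r z\<close> to \<open>c\<^sup>* z\<close>; this is well defined and bounded by \<open>norm d\<close>, because the square of
  \<open>norm (c\<^sup>* z)\<close> is the norm of \<open>ip (d (c\<^sup>* z)) (r z)\<close>, and it extends from the dense range of \<open>r\<close> by
  completeness.
\<close>

lemma range_inclusion_factor:
  assumes r: "sa r" and dense: "closure (range (app r)) = UNIV"
    and c: "c \<in> Adj" and sub: "range (app c) \<subseteq> range (app r)"
  obtains d where "d \<in> Adj" "r * d = c"
proof -
  note inj = sa_dense_range_inj[OF r dense]
  define D where "D x = (SOME y. app r y = app c x)" for x
  have D: "app r (D x) = app c x" for x
  proof -
    have "\<exists>y. app r y = app c x" using sub by (metis imageE range_subsetD rangeI)
    then show ?thesis unfolding D_def by (rule someI_ex)
  qed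
  have bl: "bounded_linear D"
  proof (rule closed_graph)
    show "linear D"
      by (rule linearI; rule inj) (simp_all add: D app_add app_scaleR)
    fix X x y assume X: "X \<longlonglongrightarrow> x" and DX: "(\<lambda>n. D (X n)) \<longlonglongrightarrow> y"
    have "(\<lambda>n. app r (D (X n))) \<longlonglongrightarrow> app r y" by (rule tendsto_app_right[OF DX])
    moreover have "(\<lambda>n. app r (D (X n))) \<longlonglongrightarrow> app c x" unfolding D by (rule tendsto_app_right[OF X])
    ultimately have "app r (D x) = app r y" using LIMSEQ_unique D by metis
    then show "D x = y" by (rule inj)
  qed
  have "D (a *\<^sub>C x) = a *\<^sub>C D x" for a x by (rule inj) (simp add: D app_scaleC)
  with bl have app_D: "app (Endo D) = D" by (simp add: Endo_inverse)
  define d where "d = Endo D"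
  have rd: "app r (app d x) = app c x" for x by (simp add: d_def app_D D)
  have cs: "ip (app c x) y = ip x (app (ad c) y)" for x y
    using ad_pair[OF c] by (simp add: adjoint_pair_def)
  have rs: "ip (app r x) y = ip x (app r y)" for x y
    using r by (simp add: adjoint_pair_def)
  have bound: "norm (app (ad c) z) \<le> norm d * norm (app r z)" for z
  proof (cases "app (ad c) z = 0")
    case False
    let ?w = "app (ad c) z"
    have "(norm ?w)\<^sup>2 = norm (ip (app c ?w) z)" by (simp add: cs norm_form_self)
    also have "ip (app c ?w) z = ip (app d ?w) (app r z)" by (simp add: rd[symmetric] rs)
    also have "norm \<dots> \<le> norm (app d ?w) * norm (app r z)" by (rule cauchy_schwarz)
    also have "\<dots> \<le> (norm d * norm ?w) * norm (app r z)" by (intro mult_right_mono app_norm) simp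
    finally have "norm ?w * norm ?w \<le> norm ?w * (norm d * norm (app r z))"
      by (simp add: power2_eq_square mult_ac)
    then show ?thesis using False by (metis mult_le_cancel_left_pos zero_less_norm_iff)
  qed simp
  have "\<exists>w. \<forall>x. ip (app d x) y = ip x w" for y
  proof -
    obtain z where z: "(\<lambda>n. app r (z n)) \<longlonglongrightarrow> y"
      using dense closure_range_sequence[of y "app r"] by blast
    have "Cauchy (\<lambda>n. app (ad c) (z n))"
    proof (rule Cauchy_dominated[OF LIMSEQ_imp_Cauchy[OF z]])
      show "norm (app (ad c) (z m) - app (ad c) (z n)) \<le> norm d * norm (app r (z m) - app r (z n))"
        for m n
        using bound[of "z m - z n"] by (simp add: app_diff)
    qed
    then obtain w where w: "(\<lambda>n. app (ad c) (z n)) \<longlonglongrightarrow> w"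
      using Cauchy_convergent_iff convergent_def by blast
    have "ip (app d x) y = ip x w" for x
    proof (rule LIMSEQ_unique)
      show "(\<lambda>n. ip (app d x) (app r (z n))) \<longlonglongrightarrow> ip (app d x) y" by (rule tendsto_form_right[OF z])
      show "(\<lambda>n. ip (app d x) (app r (z n))) \<longlonglongrightarrow> ip x w"
        unfolding rs[symmetric] rd cs by (rule tendsto_form_right[OF w])
    qed
    then show ?thesis by blast
  qed
  then have "adjointable ip (app d)" unfolding adjointable_def by metis
  then have "d \<in> Adj" by (simp add: adjointable_app)
  moreover have "r * d = c" by (rule endo_eqI) (simp add: rd)
  ultimately show ?thesis by (rule that)
qed

text \<open>
  Write \<open>x = m + n\<close> with \<open>m\<close> in the closure of the range of \<open>g = c\<^sup>4\<close> and \<open>n\<close> orthogonal to it. Then \<open>g n = 0\<close>,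
  hence \<open>c n = 0\<close> by taking roots twice, and \<open>m\<close> is a limit of vectors in the range of \<open>g\<close>, all of
  which lie in the range of \<open>c\<close>.
\<close>

lemma complemented_root_approx:
  assumes c: "sa c" and p: "p = c * c" and g: "g = p * p"
    and compl: "orthogonally_complemented ip (closure (range (app g)))"
  obtains m z where "app c x = app c m" "(\<lambda>n. app c (z n)) \<longlonglongrightarrow> m"
proof -
  have pc: "sa p" unfolding p by (intro sa_mult c refl)
  have ker: "app a x = 0" if "sa a" "app (a * a) x = 0" for a x
    using that form_definite[of "app a x"] by (simp add: adjoint_pair_def)
  obtain m n where x: "x = m + n" "m \<in> closure (range (app g))"
    and n: "\<And>y. y \<in> closure (range (app g)) \<Longrightarrow> ip y n = 0"
    using compl unfolding orthogonally_complemented_def orthogonal_complement_def by blast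
  have "ip (app g n) (app g n) = ip (app g (app g n)) n"
    using sa_mult[OF pc pc refl] by (simp add: g adjoint_pair_def)
  also have "\<dots> = 0" by (intro n subsetD[OF closure_subset]) simp
  finally have "app g n = 0" by (rule form_definite)
  then have "app c n = 0" using ker[OF c, of n] ker[OF pc, of n] by (simp add: g p)
  then have 1: "app c x = app c m" by (simp add: x app_add)
  obtain u where u: "(\<lambda>n. app g (u n)) \<longlonglongrightarrow> m"
    using x(2) by (rule closure_range_sequence)
  have "app g (u n) = app c (app (c * p) (u n))" for n
    by (simp add: g p)
  with u show ?thesis by (intro that[OF 1, of "\<lambda>n. app (c * p) (u n)"]) simp
qed

text \<open>
  Choose \<open>m = lim c z\<^sub>n\<close> with \<open>c x = c m\<close>, and \<open>w\<^sub>n\<close> with \<open>r w\<^sub>n = p z\<^sub>n\<close>. The bound makes \<open>w\<^sub>n\<close> a Cauchy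
  sequence, and its limit is mapped by \<open>r\<close> to \<open>lim c (c z\<^sub>n) = c m\<close>. In effect the map
  \<open>c z \<mapsto> r\<^sup>-\<^sup>1 p z\<close> is extended by continuity.
\<close>

lemma root_range_inclusion:
  assumes c: "sa c" "p = c * c" "g = p * p"
    and compl: "orthogonally_complemented ip (closure (range (app g)))"
    and sub: "range (app p) \<subseteq> range (app r)"
    and bound: "\<And>w z. app r w = app p z \<Longrightarrow> norm w \<le> b * norm (app c z)"
  shows "range (app c) \<subseteq> range (app r)"
proof
  fix y assume "y \<in> range (app c)"
  then obtain x where y: "y = app c x" by blast
  obtain m z where m: "app c x = app c m" and z: "(\<lambda>n. app c (z n)) \<longlonglongrightarrow> m"
    using complemented_root_approx[OF c compl] by blast
  have "\<exists>w. app r w = app p (z n)" for n using sub by (metis imageE range_subsetD rangeI)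
  then obtain w where w: "\<And>n. app r (w n) = app p (z n)" by metis
  have "Cauchy w"
  proof (rule Cauchy_dominated[OF LIMSEQ_imp_Cauchy[OF z]])
    show "norm (w m - w n) \<le> b * norm (app c (z m) - app c (z n))" for m n
      using bound[of "w m - w n" "z m - z n"] w by (simp add: app_diff)
  qed
  then obtain v where v: "w \<longlonglongrightarrow> v" using Cauchy_convergent_iff convergent_def by blast
  have "app r v = app c m"
  proof (rule LIMSEQ_unique)
    show "(\<lambda>n. app r (w n)) \<longlonglongrightarrow> app r v" by (rule tendsto_app_right[OF v])
    show "(\<lambda>n. app r (w n)) \<longlonglongrightarrow> app c m"
      unfolding w c(2) app_times by (rule tendsto_app_right[OF z])
  qed
  then show "y \<in> range (app r)" unfolding y m by (metis rangeI)
qed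

lemma mp_inverse_app:
  assumes r: "sa r" and dense: "closure (range (app r)) = UNIV"
  shows "mp_inverse ip (app r) (app r x) = x"
proof -
  have ad: "adj ip (app r) = app r" using adj_app[OF AdjI[OF r]] ad_eqI[OF r] by simp
  have "app r y = 0 \<Longrightarrow> y = 0" for y using sa_dense_range_inj[OF r dense, of y 0] by simp
  then show ?thesis
    unfolding mp_inverse_def ad dense
    by (intro the_equality) (auto intro: sa_dense_range_inj[OF r dense] exI[of _ 0])
qed

end

section \<open>The equation XHX = K\<close>

text \<open>
  Below, \<open>h\<close>, \<open>k\<close>, \<open>r\<close>, \<open>g\<close> are the elements of the operator algebra given by \<open>H\<close>, \<open>K\<close>, \<open>R\<close>, \<open>G\<close>, and
  \<open>p\<close>, \<open>c\<close> are the square root and the fourth root of \<open>g\<close>. All four conditions are compared with the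
  existence of a positive \<open>x\<close> such that \<open>r x r = p\<close>.
\<close>

theorem theorem2p6:
  fixes act :: "'e::complex_banach \<Rightarrow> 'a::cstar_algebra \<Rightarrow> 'e"
    and ip :: "'e \<Rightarrow> 'e \<Rightarrow> 'a"
    and H K R G :: "'e \<Rightarrow> 'e"
  assumes "hilbert_cstar_module act ip"
    and "op_positive ip H" and "op_positive ip K"
    and "closure (range H) = UNIV"
    and R: "R = op_powr ip H (1/2)"
    and G: "G = R \<circ> K \<circ> R"
    and "orthogonally_complemented ip (closure (range G))"
  defines "i \<equiv> \<exists>X. op_positive ip X \<and> X \<circ> H \<circ> X = K"
    and "ii \<equiv> range (op_powr ip G (1/2)) \<subseteq> range R \<and>
               range (adj ip (mp_inverse ip R \<circ> op_powr ip G (1/2))) \<subseteq> range R"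
    and "iii \<equiv> range (op_powr ip G (1/4)) \<subseteq> range R"
    and "iv \<equiv> range (op_powr ip G (1/2)) \<subseteq> range R \<and>
               (\<exists>l::real. l > 0 \<and> op_le ip (op_powr ip G (1/2)) (\<lambda>x. l *\<^sub>R H x))"
  shows "(i \<longleftrightarrow> ii) \<and> (i \<longleftrightarrow> iii) \<and> (i \<longleftrightarrow> iv)"
proof -
  interpret hilbert_cstar_module act ip by (rule assms(1))
  obtain h k where h: "pos h" "H = app h" and k: "pos k" "K = app k"
    using assms(2,3) op_positive_endo by metis
  obtain r where r: "is_cfc (\<lambda>t. t powr (1/2)) h r" "sa r" "R = app r"
    using is_cfc_powr_exists[OF h(1), of "1/2"] R h(2) by auto
  have rr: "r * r = h"
    using is_cfc_powr_mult[OF h(1) _ _ r(1) r(1)] is_cfc_powr_one[OF h(1)]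
    by (auto intro: is_cfc_unique[OF h(1)])
  define g where "g = r * k * r"
  have g: "pos g" "G = app g"
    unfolding g_def using pos_conj[OF k(1) r(2)] by (simp_all add: G r(3) k(2) app_comp)
  obtain p where p: "is_cfc (\<lambda>t. t powr (1/2)) g p" "sa p" "op_powr ip G (1/2) = app p"
    using is_cfc_powr_exists[OF g(1), of "1/2"] g(2) by auto
  obtain c where c: "is_cfc (\<lambda>t. t powr (1/4)) g c" "sa c" "op_powr ip G (1/4) = app c"
    using is_cfc_powr_exists[OF g(1), of "1/4"] g(2) by auto
  have pp: "g = p * p"
    using is_cfc_powr_mult[OF g(1) _ _ p(1) p(1)] is_cfc_powr_one[OF g(1)]
    by (auto intro: is_cfc_unique[OF g(1)])
  have cc: "p = c * c"
    using is_cfc_powr_mult[OF g(1) _ _ c(1) c(1)] p(1)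
    by (auto intro: is_cfc_unique[OF g(1)])
  have "closure (range H) \<subseteq> closure (range R)"
    unfolding h(2) r(3) rr[symmetric] by (intro closure_mono) auto
  then have dense: "closure (range (app r)) = UNIV" using assms(4) r(3) by blast
  note inj = sa_dense_range_inj[OF r(2) dense]
  note cancel = sandwich_cancel[OF r(2) dense]
  have compl': "orthogonally_complemented ip (closure (range (app g)))" using assms(7) g(2) by simp
  have rs: "ip (app r x) y = ip x (app r y)" for x y using r(2) by (simp add: adjoint_pair_def)
  have cs: "ip (app c x) y = ip x (app c y)" for x y using c(2) by (simp add: adjoint_pair_def)

  define solves where "solves x \<longleftrightarrow> pos x \<and> r * x * r = p" for x
  \<comment> \<open>uniqueness of the positive square root in one direction, cancellation of r in the other\<close>
  have i_iff: "i \<longleftrightarrow> (\<exists>x. solves x)"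
  proof
    assume i
    then obtain x where x: "pos x" "app x \<circ> app h \<circ> app x = app k"
      unfolding i_def h(2) k(2) using op_positive_endo by metis
    then have xhx: "x * h * x = k" unfolding app_comp[symmetric] app_inject by simp
    let ?q = "r * x * r"
    have q: "pos ?q" by (rule pos_conj[OF x(1) r(2)])
    have "?q * ?q = g" unfolding g_def xhx[symmetric] rr[symmetric] by (simp add: mult.assoc)
    then have "app p = app ?q" using op_powr_half_square[OF q] g p(3) by simp
    then have "?q = p" by (simp add: app_inject)
    then show "\<exists>x. solves x" using x(1) by (auto simp: solves_def)
  next
    assume "\<exists>x. solves x"
    then obtain x where x: "pos x" "r * x * r = p" by (auto simp: solves_def)
    have "r * (x * h * x) * r = r * k * r"
      unfolding g_def[symmetric] pp x(2)[symmetric] rr[symmetric] by (simp add: mult.assoc)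
    then have "x * h * x = k" by (rule cancel)
    then have "app x \<circ> app h \<circ> app x = app k" by (simp add: app_comp[symmetric])
    moreover have "op_positive ip (app x)" using x(1) by (simp add: op_positive_app)
    ultimately show i unfolding i_def h(2) k(2) by blast
  qed

  have i_ii: ii if sol: "solves x" for x
  proof -
    from sol have x: "sa x" "p = r * (x * r)" by (auto simp: solves_def pos_def mult.assoc)
    have "mp_inverse ip R \<circ> app p = app (x * r)"
      unfolding x(2) r(3) by (rule ext) (simp add: mp_inverse_app[OF r(2) dense])
    moreover have "adj ip (app (x * r)) = app (r * x)"
      using pair_mult[OF x(1) r(2)] by (simp add: adj_app[OF AdjI] ad_eqI)
    ultimately show ii unfolding ii_def p(3) r(3) x(2) by auto
  qed

  \<comment> \<open>r d = p and r y = ad d give p = r (ad y) r; both sides being self-adjoint, so is y\<close>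
  have ii_i: "\<exists>x. solves x" if ii
  proof -
    from that have sub: "range (app p) \<subseteq> range (app r)"
      and sub': "range (adj ip (mp_inverse ip (app r) \<circ> app p)) \<subseteq> range (app r)"
      unfolding ii_def p(3) r(3) by auto
    obtain d where d: "d \<in> Adj" "r * d = p"
      using range_inclusion_factor[OF r(2) dense AdjI[OF p(2)] sub] .
    have "mp_inverse ip (app r) \<circ> app p = app d"
      unfolding d(2)[symmetric] by (rule ext) (simp add: mp_inverse_app[OF r(2) dense])
    with sub' have "range (app (ad d)) \<subseteq> range (app r)" by (simp add: adj_app[OF d(1)])
    then obtain y where y: "y \<in> Adj" "r * y = ad d"
      using range_inclusion_factor[OF r(2) dense AdjI[OF adjoint_pair_sym[OF ad_pair[OF d(1)]]]] by blast
    have "adjoint_pair (r * y) (ad y * r)" by (rule pair_mult[OF r(2) ad_pair[OF y(1)]])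
    then have "d = ad y * r"
      unfolding y(2) using adjoint_pair_sym[OF ad_pair[OF d(1)]] by (metis adjoint_pair_unique)
    then have p1: "r * ad y * r = p" using d(2) by (simp add: mult.assoc)
    have "adjoint_pair (r * ad y * r) (r * (y * r))"
      by (intro pair_mult r(2) adjoint_pair_sym[OF ad_pair[OF y(1)]])
    then have p2: "r * y * r = p"
      unfolding p1 using p(2) by (metis adjoint_pair_unique mult.assoc)
    have "ad y = y" by (rule cancel) (simp add: p1 p2)
    then have say: "sa y" using ad_pair[OF y(1)] by simp
    \<comment> \<open>on the dense range of r the form of y is that of p, a square\<close>
    have "pos y"
    proof (rule pos_if_form_nonneg[OF say dense])
      fix v assume "v \<in> range (app r)"
      then obtain z where v: "v = app r z" by blast
      have "ip v (app y v) = ip z (app (r * y * r) z)" by (simp add: v rs)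
      also have "\<dots> = ip (app c z) (app c z)" unfolding p2 by (simp add: cc cs)
      finally show "\<exists>u. ip v (app y v) = ip u u" by blast
    qed
    with p2 show ?thesis by (auto simp: solves_def)
  qed

  \<comment> \<open>if r w = p z then w = x (r z), and for s the root of x the norms of s (r z) and c z agree\<close>
  have i_iii: iii if sol: "solves x" for x
  proof -
    from sol have x: "pos x" "p = r * (x * r)" by (auto simp: solves_def mult.assoc)
    have sub: "range (app p) \<subseteq> range (app r)" unfolding x(2) by auto
    obtain s where s: "sa s" "s * s = x" by (rule pos_sqrt[OF x(1)])
    have bound: "norm w \<le> norm s * norm (app c z)" if "app r w = app p z" for w z
    proof -
      have "app r w = app r (app x (app r z))" using that unfolding x(2) by simp
      then have w: "w = app x (app r z)" by (rule inj)
      have ss: "ip (app s u) v = ip u (app s v)" for u v using s(1) by (simp add: adjoint_pair_def)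
      have "ip (app s (app r z)) (app s (app r z)) = ip z (app (r * ((s * s) * r)) z)"
        by (simp add: rs ss)
      also have "\<dots> = ip (app c z) (app c z)" unfolding s(2) x(2)[symmetric] by (simp add: cc cs)
      finally have "norm (app s (app r z)) = norm (app c z)"
        using norm_form_self by (metis norm_ge_zero power2_eq_imp_eq)
      then show ?thesis
        unfolding w s(2)[symmetric] using app_norm[of s "app s (app r z)"] by simp
    qed
    show ?thesis
      unfolding iii_def c(3) r(3) by (rule root_range_inclusion[OF c(2) cc pp compl' sub bound])
  qed

  \<comment> \<open>with r d = c the solution is d (ad d)\<close>
  have iii_i: "\<exists>x. solves x" if iii
  proof -
    from that have sub: "range (app c) \<subseteq> range (app r)" unfolding iii_def c(3) r(3) .
    obtain d where d: "d \<in> Adj" "r * d = c"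
      using range_inclusion_factor[OF r(2) dense AdjI[OF c(2)] sub] .
    have "adjoint_pair (r * d) (ad d * r)" by (rule pair_mult[OF r(2) ad_pair[OF d(1)]])
    then have "ad d * r = c" unfolding d(2) using c(2) by (metis adjoint_pair_unique)
    then have "r * (d * ad d) * r = p" using d(2) cc by (metis mult.assoc)
    moreover have "pos (d * ad d)" by (rule pos_factor[OF adjoint_pair_sym[OF ad_pair[OF d(1)]]])
    ultimately show ?thesis by (auto simp: solves_def)
  qed

  have le_app: "op_le ip (app p) (\<lambda>x. l *\<^sub>R H x) \<longleftrightarrow> pos (l *\<^sub>R h - p)" for l
  proof -
    have "(\<lambda>x. l *\<^sub>R H x - app p x) = app (l *\<^sub>R h - p)" by (rule ext) (simp add: h(2))
    then show ?thesis by (simp add: op_le_def op_positive_app)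
  qed

  \<comment> \<open>the difference of the two sides is r (l - x) r for l = norm x + 1\<close>
  have i_iv: iv if sol: "solves x" for x
  proof -
    from sol have x: "pos x" "r * x * r = p" by (auto simp: solves_def)
    have "pos (r * ((norm x + 1) *\<^sub>R 1 - x) * r)"
      by (rule pos_conj[OF pos_norm_minus[OF pos_sa[OF x(1)]] r(2)]) simp
    also have "r * ((norm x + 1) *\<^sub>R 1 - x) * r = (norm x + 1) *\<^sub>R h - p"
      unfolding x(2)[symmetric] rr[symmetric] by (simp add: left_diff_distrib right_diff_distrib)
    finally have "pos ((norm x + 1) *\<^sub>R h - p)" .
    moreover have "norm x + 1 > 0" by (simp add: add_nonneg_pos)
    moreover have "range (app p) \<subseteq> range (app r)" unfolding x(2)[symmetric] by auto
    ultimately show iv unfolding iv_def p(3) r(3) le_app by blast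
  qed

  \<comment> \<open>the order relation bounds c by r; pairing w with the dense range of r bounds w by c z\<close>
  have iv_iii: iii if iv
  proof -
    from that obtain l where sub: "range (app p) \<subseteq> range (app r)"
      and l: "l > 0" "pos (l *\<^sub>R h - p)"
      unfolding iv_def p(3) r(3) le_app by auto
    obtain s where s: "sa s" "s * s = l *\<^sub>R h - p" by (rule pos_sqrt[OF l(2)])
    have cr: "norm (app c v) \<le> sqrt l * norm (app r v)" for v
    proof -
      have "ip (app s v) (app s v) = ip v (app (s * s) v)" using s(1) by (simp add: adjoint_pair_def)
      also have "\<dots> = l *\<^sub>R ip (app r v) (app r v) - ip (app c v) (app c v)"
        unfolding s(2) by (simp add: cc rr[symmetric] rs cs form_diff_right)
      finally have "norm (ip (app c v) (app c v)) \<le> norm (l *\<^sub>R ip (app r v) (app r v))"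
        using norm_ip_self_mono[of "app c v" "app s v"] by simp
      then have "(norm (app c v))\<^sup>2 \<le> (sqrt l * norm (app r v))\<^sup>2"
        using l(1) by (simp add: norm_form_self power_mult_distrib)
      then show ?thesis by (rule power2_le_imp_le) (use l(1) in simp)
    qed
    have bound: "norm w \<le> sqrt l * norm (app c z)" if w: "app r w = app p z" for w z
    proof -
      have "norm (ip w (app r v)) \<le> sqrt l * norm (app c z) * norm (app r v)" for v
      proof -
        have "ip w (app r v) = ip (app c z) (app c v)" by (simp add: rs[symmetric] w cc cs)
        then have "norm (ip w (app r v)) \<le> norm (app c z) * norm (app c v)"
          using cauchy_schwarz by simp
        also have "\<dots> \<le> norm (app c z) * (sqrt l * norm (app r v))" by (intro mult_left_mono cr) simp
        finally show ?thesis by (simp add: mult_ac)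
      qed
      then have "range (app r) \<subseteq> {y. norm (ip w y) \<le> sqrt l * norm (app c z) * norm y}" by blast
      moreover have "closed {y. norm (ip w y) \<le> sqrt l * norm (app c z) * norm y}"
        by (intro closed_Collect_le continuous_intros
            bounded_linear.continuous_on[OF bounded_linear_form_right])
      ultimately have "closure (range (app r)) \<subseteq> {y. norm (ip w y) \<le> sqrt l * norm (app c z) * norm y}"
        by (rule closure_minimal)
      then have "norm (ip w w) \<le> sqrt l * norm (app c z) * norm w" unfolding dense by blast
      then show ?thesis
        by (cases "w = 0") (use l(1) in \<open>simp_all add: norm_form_self power2_eq_square\<close>)
    qed
    show ?thesis
      unfolding iii_def c(3) r(3) by (rule root_range_inclusion[OF c(2) cc pp compl' sub bound])
  qed

  show ?thesis
    unfolding i_iff using i_ii ii_i i_iii iii_i i_iv iv_iii by blast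
qed

end
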